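(* Let $0<\alpha<1$ and $K>0$, and let $a$ be a fixed cut-off function as in the context. Let $\lambda\to\infty$, with $\gamma=\gamma(\lambda)\to\infty$ such that $N=\gamma\lambda$ is an integer, and let $p=p(\lambda)\in[0,1]$ satisfy $$|p-0.5|\le K\lambda^{-\alpha/2}\gamma^{-1/2}.$$ Let $u(x)=\gamma^{-1/2}\lambda^{-1/2}\sum_{j=1}^{N}C_j e^{i\lambda x\cdot\xi_j}$, $x\in\mathbb{R}^2$, be the normalised random wave with directions $\xi_1,\dots,\xi_N$ equally spaced on the unit circle and independent coefficients $C_j$ each equal to $+1$ with probability $p$ and $-1$ with probability $1-p$. Then $$\sigma^2\left[\|a_\lambda u\|_{L^2}^2\right]=o\left(\mathrm{Vol}(B_{\lambda^{-\alpha}}(0))^2\right)\quad\text{as }\lambda\to\infty,$$ and hence $u$ has the weak equidistribution property on the ball of radius $\lambda^{-\alpha}$: in addition to this variance condition, there are constants $c,C>0$, independent of $\lambda$ and $\gamma$, such that for all sufficiently large $\lambda$ $$c\,\mathrm{Vol}(B_{\lambda^{-\alpha}}(0))\le\mathbb{E}\left[\|a_\lambda u\|_{L^2}^2\right]\le C\,\mathrm{Vol}(B_{\lambda^{-\alpha}}(0)).$$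
   Context: The cut-off $a:\mathbb{R}\to\mathbb{R}$ is a fixed smooth function supported on $[-2,2]$ and equal to $1$ on $[-1,1]$. For $x\in\mathbb{R}^2$ put $a_\lambda(x)=a(\lambda^\alpha|x|)$, so $\|a_\lambda u\|_{L^2}^2=\int_{\mathbb{R}^2}a^2(\lambda^\alpha|x|)\,|u(x)|^2\,dx$; this is the smoothed version of $\int_{B_{\lambda^{-\alpha}}(0)}|u|^2dx$. $B_r(0)\subset\mathbb{R}^2$ is the disc of radius $r$ about $0$ and $\mathrm{Vol}$ is its area. The $N=\gamma\lambda$ directions $\xi_j$ lie on the unit circle $\mathbb{S}\subset\mathbb{R}^2$, with angle $2\pi/(\gamma\lambda)$ between consecutive directions. $\mathbb{E}$ and $\sigma^2[Y]=\mathbb{E}[(Y-\mathbb{E}[Y])^2]$ are expectation and variance over the random coefficients. Weak equidistribution on a set $X$ means that $c\,\mathrm{Vol}(X)\le\mathbb{E}[\int_X|u|^2dx]\le C\,\mathrm{Vol}(X)$ and $\sigma^2[\int_X|u|^2dx]=o(\mathrm{Vol}(X)^2)$; here it is understood for $X=B_{\lambda^{-\alpha}}(0)$ with the smoothed integral. *)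

theory Defs
  imports "HOL-Probability.Probability" "HOL-Library.Landau_Symbols"
begin

definition smooth :: "(real \<Rightarrow> real) \<Rightarrow> bool" where
  "smooth f \<longleftrightarrow> (\<forall>k x. (deriv ^^ k) f differentiable (at x))"

definition cutoff_function :: "(real \<Rightarrow> real) \<Rightarrow> bool" where
  "cutoff_function a \<longleftrightarrow>
     smooth a \<and> {t. a t \<noteq> 0} \<subseteq> {-2..2} \<and> (\<forall>t\<in>{-1..1}. a t = 1)"

definition scaled_cutoff :: "(real \<Rightarrow> real) \<Rightarrow> real \<Rightarrow> real \<Rightarrow> real ^ 2 \<Rightarrow> real" where
  "scaled_cutoff a \<alpha> lam x = a (lam powr \<alpha> * norm x)"

definition L2_norm_sq :: "(real ^ 2 \<Rightarrow> complex) \<Rightarrow> real" where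
  "L2_norm_sq f = (\<integral>x. (cmod (f x))\<^sup>2 \<partial>lborel)"

text \<open>The position \<open>\<theta>\<close> of the configuration on the circle is not prescribed.\<close>

definition equally_spaced_directions :: "nat \<Rightarrow> (nat \<Rightarrow> real ^ 2) \<Rightarrow> bool" where
  "equally_spaced_directions N \<xi> \<longleftrightarrow>
     (\<exists>\<theta>::real. \<forall>j\<in>{1..N}.
        \<xi> j = vector [cos (\<theta> + 2 * pi * real j / real N), sin (\<theta> + 2 * pi * real j / real N)])"

definition independent_signs :: "'w measure \<Rightarrow> real \<Rightarrow> nat \<Rightarrow> (nat \<Rightarrow> 'w \<Rightarrow> real) \<Rightarrow> bool" where
  "independent_signs M p N X \<longleftrightarrow>
     prob_space M \<and> prob_space.indep_vars M (\<lambda>_. borel) X {1..N} \<and>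
     (\<forall>j\<in>{1..N}. measure M {\<omega> \<in> space M. X j \<omega> = 1} = p \<and>
                 measure M {\<omega> \<in> space M. X j \<omega> = -1} = 1 - p)"

definition wave ::
    "real \<Rightarrow> real \<Rightarrow> nat \<Rightarrow> (nat \<Rightarrow> real ^ 2) \<Rightarrow> (nat \<Rightarrow> real) \<Rightarrow> real ^ 2 \<Rightarrow> complex" where
  "wave \<gamma> lam N \<xi> s x =
     of_real (\<gamma> powr (-1/2) * lam powr (-1/2)) *
     (\<Sum>j=1..N. of_real (s j) * exp (\<i> * of_real (lam * (x \<bullet> \<xi> j))))"

definition local_mass ::
    "(real \<Rightarrow> real) \<Rightarrow> real \<Rightarrow> real \<Rightarrow> (real ^ 2 \<Rightarrow> complex) \<Rightarrow> real" where
  "local_mass a \<alpha> lam u = L2_norm_sq (\<lambda>x. of_real (scaled_cutoff a \<alpha> lam x) * u x)"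

definition disc_area :: "real \<Rightarrow> real" where
  "disc_area r = measure lborel (ball (0 :: real ^ 2) r)"

end

theory Submission
  imports Defs
begin

text \<open>
  With \<open>L = \<lambda>\<^sup>\<alpha>\<close> the mass is \<open>1 / N\<close> times the quadratic form in the signs whose coefficients
  \<open>g\<^sub>j\<^sub>k\<close> are the values at \<open>\<lambda> (\<xi>\<^sub>j - \<xi>\<^sub>k)\<close> of the cosine transform of \<open>a\<^sup>2 (L \<bar>x\<bar>)\<close>. Since the
  profile is twice differentiable, this transform at \<open>w\<close> is \<open>O((L + \<bar>w\<bar>)\<^sup>-\<^sup>2)\<close>, so the entries are
  \<open>O(L\<^sup>-\<^sup>2)\<close> and, the directions being equally spaced, every row sum is \<open>O(T / L\<^sup>2)\<close> with
  \<open>T = \<gamma> L\<close>. Let \<open>q = 2 p - 1\<close> be the mean of a sign, so that \<open>q\<^sup>2 = O(1 / T)\<close>. Centring the signs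
  splits the form into a constant, a linear and an off-diagonal quadratic part: the off-diagonal
  part of the expectation is \<open>q\<^sup>2\<close> times a row sum, and the variance is
  \<open>O(N\<^sup>-\<^sup>2 (q\<^sup>2 N (T / L\<^sup>2)\<^sup>2 + N T / L\<^sup>4)) = O(L\<^sup>-\<^sup>4 T / N)\<close>, where \<open>T / N = \<lambda>\<^sup>\<alpha>\<^sup>-\<^sup>1 \<longlongrightarrow> 0\<close>.
\<close>

section \<open>Second differences of the squared cutoff\<close>

text \<open>Taylor's formula at 0 with Lagrange remainder, taken at 1 and at -1: the first-order
  terms cancel, and each remainder is at most half of \<open>B\<close>.\<close>

lemma second_difference_bound:
  fixes f f' f'' :: "real \<Rightarrow> real"
  assumes f': "\<And>t. (f has_real_derivative f' t) (at t)"
    and f'': "\<And>t. (f' has_real_derivative f'' t) (at t)"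
    and B: "\<And>t. \<bar>f'' t\<bar> \<le> B"
  shows "\<bar>f 1 + f (-1) - 2 * f 0\<bar> \<le> B"
proof -
  define d where "d = (\<lambda>m::nat. if m = 0 then f else if m = 1 then f' else f'')"
  have d: "\<forall>m t. m < 2 \<and> -1 \<le> t \<and> t \<le> 1 \<longrightarrow> DERIV (d m) t :> d (Suc m) t"
    using f' f'' by (auto simp: d_def less_2_cases_iff)
  have "\<exists>t. f x = f 0 + f' 0 * x + f'' t / 2" if "x = 1 \<or> x = -1" for x
  proof -
    have "\<exists>t. (if x < 0 then x < t \<and> t < 0 else 0 < t \<and> t < x) \<and>
        f x = (\<Sum>m<2. (d m 0 / fact m) * (x - 0)^m) + (d 2 t / fact 2) * (x - 0)^2"
      by (rule Taylor[where a = "-1" and b = 1]) (use d that in \<open>auto simp: d_def\<close>)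
    then show ?thesis
      using that by (auto simp: d_def numeral_2_eq_2)
  qed
  from this[of 1] this[of "-1"] obtain t u
    where "f 1 = f 0 + f' 0 * 1 + f'' t / 2" "f (-1) = f 0 + f' 0 * (-1) + f'' u / 2"
    by auto
  then show ?thesis
    using B[of t] B[of u] by linarith
qed

lemma continuous_vanishing_bounded:
  fixes f :: "real \<Rightarrow> real"
  assumes "continuous_on UNIV f" and "\<And>t. \<bar>t\<bar> > R \<Longrightarrow> f t = 0"
  obtains M where "\<And>t. \<bar>f t\<bar> \<le> M" "M \<ge> 0"
proof -
  have "bounded (f ` {-R..R})"
    by (intro compact_imp_bounded compact_continuous_image continuous_on_subset[OF assms(1)]) auto
  then obtain M where M: "\<And>t. t \<in> {-R..R} \<Longrightarrow> \<bar>f t\<bar> \<le> M" "M > 0"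
    by (force simp: bounded_pos)
  have "\<bar>f t\<bar> \<le> M" for t
    using M assms(2)[of t] by (cases "\<bar>t\<bar> > R") (auto simp: abs_le_iff not_less)
  then show thesis
    using that M(2) by force
qed

text \<open>On an open set where a function is constant, uniqueness of derivatives forces its
  derivative to be 0. This is why the vanishing of \<open>a1\<close> and \<open>a2\<close> is stated
  with strict inequalities.\<close>

lemma cutoff_derivatives:
  assumes "cutoff_function a"
  obtains a1 a2 where
    "\<And>t. (a has_real_derivative a1 t) (at t)" "\<And>t. (a1 has_real_derivative a2 t) (at t)"
    "continuous_on UNIV a2"
    "\<And>t. \<bar>t\<bar> < 1 \<Longrightarrow> a1 t = 0" "\<And>t. \<bar>t\<bar> < 1 \<Longrightarrow> a2 t = 0"
    "\<And>t. \<bar>t\<bar> > 2 \<Longrightarrow> a t = 0" "\<And>t. \<bar>t\<bar> > 2 \<Longrightarrow> a1 t = 0"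
proof -
  define a1 where "a1 = deriv a"
  define a2 where "a2 = deriv a1"
  have sm: "(deriv ^^ k) a differentiable (at x)" for k x
    using assms by (auto simp: cutoff_function_def smooth_def)
  have d1: "(a has_real_derivative a1 t) (at t)" for t
    using sm[of 0 t] by (simp add: a1_def DERIV_deriv_iff_real_differentiable)
  have d2: "(a1 has_real_derivative a2 t) (at t)" for t
    using sm[of 1 t] by (simp add: a2_def a1_def DERIV_deriv_iff_real_differentiable)
  have "a2 differentiable (at t)" for t
    using sm[of 2 t] by (simp add: a2_def a1_def numeral_2_eq_2)
  then have cont: "continuous_on UNIV a2"
    by (meson continuous_at_imp_continuous_on differentiable_imp_continuous_within)
  have one: "a t = 1" if "\<bar>t\<bar> < 1" for t
    using assms that by (auto simp: cutoff_function_def abs_less_iff)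
  have zero: "a t = 0" if "\<bar>t\<bar> > 2" for t
    using assms that unfolding cutoff_function_def by fastforce
  have local_const: "f' t = 0"
    if "open S" "t \<in> S" "\<And>u. u \<in> S \<Longrightarrow> f u = c" "\<And>t. (f has_real_derivative f' t) (at t)"
    for f f' :: "real \<Rightarrow> real" and S t c
  proof -
    have "((\<lambda>u. c) has_real_derivative f' t) (at t)"
      using has_field_derivative_transform_within_open[OF that(4) that(1,2)] that(3) by auto
    then show ?thesis
      using DERIV_const DERIV_unique by blast
  qed
  have a1_in: "a1 t = 0" if "\<bar>t\<bar> < 1" for t
    using local_const[of "{-1<..<1}" t a 1 a1] that d1 one by force
  have a2_in: "a2 t = 0" if "\<bar>t\<bar> < 1" for t
    using local_const[of "{-1<..<1}" t a1 0 a2] that d2 a1_in by force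
  have "open {t::real. \<bar>t\<bar> > 2}"
    by (intro open_Collect_less continuous_intros)
  then have a1_out: "a1 t = 0" if "\<bar>t\<bar> > 2" for t
    using local_const[of "{t. \<bar>t\<bar> > 2}" t a 0 a1] that d1 zero by force
  show thesis
    using that d1 d2 cont a1_in a2_in zero a1_out by blast
qed

text \<open>The square of the norm is smooth, so \<open>(a (norm x))\<^sup>2\<close> is handled as a smooth function of
  \<open>s = (norm x)\<^sup>2\<close>; it is constant near the singular point \<open>s = 0\<close> of the square root.\<close>

lemma cutoff_square_profile:
  assumes "cutoff_function a"
  obtains c1 c2 M where
    "\<And>s. s \<ge> 0 \<Longrightarrow> ((\<lambda>s. (a (sqrt s))\<^sup>2) has_real_derivative c1 s) (at s)"
    "\<And>s. s \<ge> 0 \<Longrightarrow> (c1 has_real_derivative c2 s) (at s)"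
    "\<And>s. s \<ge> 0 \<Longrightarrow> \<bar>c1 s\<bar> \<le> M" "\<And>s. s \<ge> 0 \<Longrightarrow> \<bar>c2 s\<bar> * s \<le> M" "M \<ge> 0"
proof -
  obtain a1 a2 where
    d1: "\<And>t. (a has_real_derivative a1 t) (at t)" and d2: "\<And>t. (a1 has_real_derivative a2 t) (at t)"
    and cont: "continuous_on UNIV a2"
    and inner: "\<And>t. \<bar>t\<bar> < 1 \<Longrightarrow> a1 t = 0" "\<And>t. \<bar>t\<bar> < 1 \<Longrightarrow> a2 t = 0"
    and outer: "\<And>t. \<bar>t\<bar> > 2 \<Longrightarrow> a t = 0" "\<And>t. \<bar>t\<bar> > 2 \<Longrightarrow> a1 t = 0"
    using cutoff_derivatives[OF assms] by metis
  have one: "a t = 1" if "\<bar>t\<bar> < 1" for t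
    using assms that by (auto simp: cutoff_function_def abs_less_iff)
  \<comment> \<open>\<open>A1\<close> and \<open>A2\<close> are the first two derivatives of the
    square of \<open>a\<close>. The chain rule for composition with \<open>sqrt\<close> turns them
    into \<open>c1\<close> and \<open>c2\<close> below.\<close>
  define A1 where "A1 t = 2 * a t * a1 t" for t
  define A2 where "A2 t = 2 * (a1 t)\<^sup>2 + 2 * a t * a2 t" for t
  have conts: "continuous_on UNIV a" "continuous_on UNIV a1"
    using d1 d2 by (meson DERIV_isCont continuous_at_imp_continuous_on)+
  have dA1: "(A1 has_real_derivative A2 t) (at t)" for t
    unfolding A1_def[abs_def] A2_def
    by (auto intro!: derivative_eq_intros d1 d2 simp: power2_eq_square)
  have "continuous_on UNIV A1" "continuous_on UNIV A2"
    unfolding A1_def[abs_def] A2_def[abs_def] by (intro continuous_intros conts cont)+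
  then obtain M1 M2 where M1: "\<And>t. \<bar>A1 t\<bar> \<le> M1" "M1 \<ge> 0" and M2: "\<And>t. \<bar>A2 t\<bar> \<le> M2" "M2 \<ge> 0"
    using continuous_vanishing_bounded[of A1 2] continuous_vanishing_bounded[of A2 2] outer
    by (metis A1_def A2_def mult_zero_right mult_zero_left add_0 power_zero_numeral)
  define c1 where "c1 s = A1 (sqrt s) / (2 * sqrt s)" for s
  define c2 where "c2 s = A2 (sqrt s) / (4 * s) - A1 (sqrt s) / (4 * s * sqrt s)" for s
  \<comment> \<open>\<open>sqrt\<close> is an odd function on the reals, so small negative
    \<open>s\<close> are covered as well; this yields two-sided derivatives at \<open>s = 0\<close>.
    The numerators in \<open>c1\<close> and \<open>c2\<close> vanish there, so both quotients are 0
    in spite of the zero denominators.\<close>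
  have in0: "A1 (sqrt s) = 0" "A2 (sqrt s) = 0" "a (sqrt s) = 1" if "\<bar>s\<bar> < 1" for s
  proof -
    have "\<bar>sqrt s\<bar> < 1"
      using that by (simp flip: real_sqrt_abs2 add: real_sqrt_abs' abs_if real_sqrt_minus[symmetric])
    then show "A1 (sqrt s) = 0" "A2 (sqrt s) = 0" "a (sqrt s) = 1"
      using inner one by (auto simp: A1_def A2_def)
  qed
  have c1: "((\<lambda>s. (a (sqrt s))\<^sup>2) has_real_derivative c1 s) (at s)" if "s \<ge> 0" for s
  proof (cases "s < 1")
    case True
    have "((\<lambda>s. 1) has_real_derivative c1 s) (at s)"
      using True that in0[of s] by (simp add: c1_def)
    then show ?thesis
      by (rule has_field_derivative_transform_within_open[where S = "{-1<..<1}"])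
        (use that True in0(3) in auto)
  next
    case False
    then have "((\<lambda>s. a (sqrt s)) has_real_derivative a1 (sqrt s) * (inverse (sqrt s) / 2)) (at s)"
      by (intro DERIV_chain2[OF d1] DERIV_real_sqrt) auto
    from DERIV_power[OF this, of 2] show ?thesis
      by (simp add: c1_def A1_def field_simps)
  qed
  have c2: "(c1 has_real_derivative c2 s) (at s)" if "s \<ge> 0" for s
  proof (cases "s < 1")
    case True
    have "((\<lambda>s. 0) has_real_derivative c2 s) (at s)"
      using True that in0[of s] by (simp add: c2_def)
    then show ?thesis
      by (rule has_field_derivative_transform_within_open[where S = "{-1<..<1}"])
        (use that True in0(1) in \<open>auto simp: c1_def\<close>)
  next
    case False
    then have s: "s > 0" "sqrt s * sqrt s = s" by auto
    have "((\<lambda>s. A1 (sqrt s)) has_real_derivative A2 (sqrt s) * (inverse (sqrt s) / 2)) (at s)"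
      using s by (intro DERIV_chain2[OF dA1] DERIV_real_sqrt) auto
    moreover have "((\<lambda>s. 2 * sqrt s) has_real_derivative inverse (sqrt s)) (at s)"
      using s by (auto intro!: derivative_eq_intros)
    ultimately have "((\<lambda>s. A1 (sqrt s) / (2 * sqrt s)) has_real_derivative
       (A2 (sqrt s) * (inverse (sqrt s) / 2) * (2 * sqrt s) - A1 (sqrt s) * inverse (sqrt s))
         / (2 * sqrt s * (2 * sqrt s))) (at s)"
      using s by (intro DERIV_divide) auto
    also have "(A2 (sqrt s) * (inverse (sqrt s) / 2) * (2 * sqrt s) - A1 (sqrt s) * inverse (sqrt s))
         / (2 * sqrt s * (2 * sqrt s)) = c2 s"
      using s by (simp add: c2_def field_simps)
    finally show ?thesis
      unfolding c1_def[abs_def] .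
  qed
  have b1: "\<bar>c1 s\<bar> \<le> M1 + M2" if "s \<ge> 0" for s
  proof (cases "s < 1")
    case True
    then show ?thesis using in0[of s] that M1(2) M2(2) by (simp add: c1_def)
  next
    case False
    then have "sqrt s \<ge> 1" by simp
    then have "\<bar>A1 (sqrt s)\<bar> / (2 * sqrt s) \<le> \<bar>A1 (sqrt s)\<bar> / 1"
      by (intro divide_left_mono) linarith+
    then have "\<bar>c1 s\<bar> \<le> \<bar>A1 (sqrt s)\<bar>"
      using that by (simp add: c1_def)
    then show ?thesis using M1(1)[of "sqrt s"] M2(2) by linarith
  qed
  have b2: "\<bar>c2 s\<bar> * s \<le> M1 + M2" if "s \<ge> 0" for s
  proof (cases "s < 1")
    case True
    then show ?thesis using in0[of s] that M1(2) M2(2) by (simp add: c2_def)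
  next
    case False
    then have s: "sqrt s \<ge> 1" "s > 0" by auto
    have "c2 s * s = A2 (sqrt s) / 4 - A1 (sqrt s) / (4 * sqrt s)"
      using s by (simp add: c2_def field_simps)
    moreover have "\<bar>A1 (sqrt s) / (4 * sqrt s)\<bar> \<le> \<bar>A1 (sqrt s)\<bar> / 1"
      using s(1) by (simp only: abs_divide) (intro divide_left_mono; linarith)
    ultimately have "\<bar>c2 s * s\<bar> \<le> M1 + M2"
      using M1(1)[of "sqrt s"] M2(1)[of "sqrt s"] by linarith
    then show ?thesis using s by (simp add: abs_mult)
  qed
  show thesis
    using that[OF c1 c2 b1 b2] M1(2) M2(2) by simp
qed

text \<open>Along the line through \<open>x\<close> with direction \<open>h\<close> the squared norm
  is a quadratic polynomial \<open>s\<close> in \<open>t\<close>, so the second derivative is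
  \<open>c2 (s t) * d t * d t + 2 * (h \<bullet> h) * c1 (s t)\<close>. Cauchy-Schwarz bounds the
  square of \<open>d t\<close> by \<open>4 * s t\<close> times the square of \<open>norm h\<close>,
  which is why the bound on \<open>c2\<close> carries the weight \<open>s\<close>. The two terms
  contribute 4 and 2 to the factor 6.\<close>

lemma cutoff_square_second_difference:
  assumes "cutoff_function a"
  obtains M where "M \<ge> 0"
    "\<And>x h :: 'a::real_inner. \<bar>(a (norm (x + h)))\<^sup>2 + (a (norm (x - h)))\<^sup>2 - 2 * (a (norm x))\<^sup>2\<bar> \<le> M * (norm h)\<^sup>2"
proof -
  obtain c1 c2 M where
    c1: "\<And>s. s \<ge> 0 \<Longrightarrow> ((\<lambda>s. (a (sqrt s))\<^sup>2) has_real_derivative c1 s) (at s)" and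
    c2: "\<And>s. s \<ge> 0 \<Longrightarrow> (c1 has_real_derivative c2 s) (at s)" and
    b1: "\<And>s. s \<ge> 0 \<Longrightarrow> \<bar>c1 s\<bar> \<le> M" and b2: "\<And>s. s \<ge> 0 \<Longrightarrow> \<bar>c2 s\<bar> * s \<le> M" and M: "M \<ge> 0"
    using cutoff_square_profile[OF assms] by metis
  have "\<bar>(a (norm (x + h)))\<^sup>2 + (a (norm (x - h)))\<^sup>2 - 2 * (a (norm x))\<^sup>2\<bar> \<le> (6 * M) * (norm h)\<^sup>2"
    for x h :: 'a
  proof -
    define y where "y t = x + t *\<^sub>R h" for t
    define s where "s t = y t \<bullet> y t" for t
    define d where "d t = 2 * (y t \<bullet> h)" for t
    have s_eq: "s = (\<lambda>t. x \<bullet> x + 2 * t * (x \<bullet> h) + t\<^sup>2 * (h \<bullet> h))"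
      by (auto simp: s_def y_def fun_eq_iff algebra_simps inner_commute power2_eq_square)
    have d_eq: "d = (\<lambda>t. 2 * (x \<bullet> h) + 2 * t * (h \<bullet> h))"
      by (auto simp: d_def y_def fun_eq_iff algebra_simps)
    have ds: "(s has_real_derivative d t) (at t)" for t
      unfolding s_eq d_eq by (auto intro!: derivative_eq_intros)
    have dd: "(d has_real_derivative 2 * (h \<bullet> h)) (at t)" for t
      unfolding d_eq by (auto intro!: derivative_eq_intros)
    have s0: "s t \<ge> 0" for t by (simp add: s_def)
    have f1: "((\<lambda>t. (a (sqrt (s t)))\<^sup>2) has_real_derivative c1 (s t) * d t) (at t)" for t
      by (rule DERIV_chain2[OF c1[OF s0] ds])
    have f2: "((\<lambda>t. c1 (s t) * d t) has_real_derivative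
        c2 (s t) * d t * d t + 2 * (h \<bullet> h) * c1 (s t)) (at t)" for t
      by (rule DERIV_mult[OF DERIV_chain2[OF c2[OF s0] ds] dd])
    have "\<bar>c2 (s t) * d t * d t + 2 * (h \<bullet> h) * c1 (s t)\<bar> \<le> (6 * M) * (norm h)\<^sup>2" for t
    proof -
      have "(d t)\<^sup>2 \<le> 4 * (s t * (norm h)\<^sup>2)"
        using Cauchy_Schwarz_ineq[of "y t" h]
        by (simp add: d_def s_def power_mult_distrib power2_norm_eq_inner)
      then have "\<bar>c2 (s t)\<bar> * (d t)\<^sup>2 \<le> 4 * (\<bar>c2 (s t)\<bar> * s t) * (norm h)\<^sup>2"
        using mult_left_mono[of "(d t)\<^sup>2" "4 * (s t * (norm h)\<^sup>2)" "\<bar>c2 (s t)\<bar>"] by (simp add: mult_ac)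
      also have "\<dots> \<le> 4 * M * (norm h)\<^sup>2"
        using b2[OF s0[of t]] by (intro mult_right_mono) auto
      finally have "\<bar>c2 (s t) * d t * d t\<bar> \<le> 4 * M * (norm h)\<^sup>2"
        by (simp add: abs_mult power2_eq_square mult_ac)
      moreover have "\<bar>2 * (h \<bullet> h) * c1 (s t)\<bar> \<le> 2 * M * (norm h)\<^sup>2"
        using mult_right_mono[OF b1[OF s0[of t]], of "(norm h)\<^sup>2"]
        by (simp add: abs_mult power2_norm_eq_inner mult_ac)
      ultimately show ?thesis by linarith
    qed
    from second_difference_bound[OF f1 f2 this] show ?thesis
      by (simp add: s_def y_def flip: norm_eq_sqrt_inner)
  qed
  then show thesis
    using that[of "6 * M"] M by simp
qed

section \<open>Decay of the cosine transform\<close>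

lemma integrable_bounded_support:
  fixes f :: "'a::euclidean_space \<Rightarrow> real"
  assumes "f \<in> borel_measurable borel" "\<And>x. \<bar>f x\<bar> \<le> B" "\<And>x. norm x > R \<Longrightarrow> f x = 0"
  shows "integrable lborel f" "\<bar>\<integral>x. f x \<partial>lborel\<bar> \<le> B * measure lborel (cball (0::'a) R)"
proof -
  have int: "integrable lborel (\<lambda>x. B * indicator (cball (0::'a) R) x)"
    by (intro integrable_mult_right integrable_real_indicator) (use emeasure_lborel_cball_finite in auto)
  have le: "\<bar>f x\<bar> \<le> B * indicator (cball 0 R) x" for x
    using assms(2)[of x] assms(3)[of x] by (auto simp: indicator_def)
  show f: "integrable lborel f"
    by (rule Bochner_Integration.integrable_bound[OF int])
      (use assms(1) le in \<open>auto intro!: order_trans[OF le]\<close>)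
  have "\<bar>\<integral>x. f x \<partial>lborel\<bar> \<le> (\<integral>x. \<bar>f x\<bar> \<partial>lborel)"
    by (rule integral_abs_bound)
  also have "\<dots> \<le> (\<integral>x. B * indicator (cball (0::'a) R) x \<partial>lborel)"
    by (intro integral_mono f integrable_abs int le)
  finally show "\<bar>\<integral>x. f x \<partial>lborel\<bar> \<le> B * measure lborel (cball (0::'a) R)"
    by simp
qed

lemma lborel_integral_translation:
  fixes f :: "'a::euclidean_space \<Rightarrow> real"
  assumes [measurable]: "f \<in> borel_measurable borel"
  shows "(\<integral>x. f (x + c) \<partial>lborel) = (\<integral>x. f x \<partial>lborel)"
proof -
  have "(\<integral>x. f x \<partial>lborel) = (\<integral>x. f x \<partial>(distr lborel borel ((+) c)))"
    by (simp add: lborel_distr_plus)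
  also have "\<dots> = (\<integral>x. f (c + x) \<partial>lborel)"
    by (rule integral_distr) auto
  finally show ?thesis by (simp add: add.commute)
qed

text \<open>Shifting by \<open>h = \<pi> w / \<bar>w\<bar>\<^sup>2\<close> changes the sign of \<open>cos (x \<bullet> w)\<close>, so the cosine transform
  of \<open>f\<close> is \<open>- 1 / 4\<close> times that of its second difference; this replaces integrating by parts twice.\<close>

lemma cosine_transform_bound:
  fixes f :: "'a::euclidean_space \<Rightarrow> real" and w :: 'a
  defines "h \<equiv> (pi / (norm w)\<^sup>2) *\<^sub>R w"
  assumes meas [measurable]: "f \<in> borel_measurable borel" and B: "\<And>x. \<bar>f x\<bar> \<le> B"
    and R: "\<And>x. norm x > R \<Longrightarrow> f x = 0" and w: "w \<noteq> 0"
    and D: "\<And>x. \<bar>f (x + h) + f (x - h) - 2 * f x\<bar> \<le> D"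
  shows "\<bar>\<integral>x. f x * cos (x \<bullet> w) \<partial>lborel\<bar> \<le> D / 4 * measure lborel (cball (0::'a) (R + norm h))"
proof -
  define I where "I = (\<integral>x. f x * cos (x \<bullet> w) \<partial>lborel)"
  have hw: "h \<bullet> w = pi"
    using w by (simp add: h_def power2_norm_eq_inner)
  have B0: "B \<ge> 0" using B[of 0] by linarith
  have bc: "\<bar>f y * cos t\<bar> \<le> B" for y t
    using mult_mono[OF B[of y] abs_cos_le_one[of t]] B0 by (simp add: abs_mult)
  \<comment> \<open>Allowing every shift \<open>c\<close> of length at most \<open>norm h\<close>
    lets one statement serve the shifts \<open>h\<close>, \<open>- h\<close> and 0.\<close>
  have supp: "f (x + c) = 0" if "norm x > R + norm h" "norm c \<le> norm h" for x c
    using R[of "x + c"] norm_triangle_ineq4[of "x + c" c] that by simp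
  have int: "integrable lborel (\<lambda>x. f (x + c) * cos (x \<bullet> w))" if "norm c \<le> norm h" for c
    by (rule integrable_bounded_support[where B = B and R = "R + norm h"])
      (use supp that bc in \<open>auto intro!: borel_measurable_times\<close>)
  have plus: "(\<integral>x. f (x + h) * cos (x \<bullet> w) \<partial>lborel) = - I"
  proof -
    have "(\<integral>x. f (x + h) * cos (x \<bullet> w) \<partial>lborel) = (\<integral>x. - (f (x + h) * cos ((x + h) \<bullet> w)) \<partial>lborel)"
      by (simp add: inner_add_left hw)
    then show ?thesis
      using lborel_integral_translation[of "\<lambda>x. f x * cos (x \<bullet> w)" h] by (simp add: I_def)
  qed
  have minus: "(\<integral>x. f (x - h) * cos (x \<bullet> w) \<partial>lborel) = - I"
  proof -
    have "(\<integral>x. f (x - h) * cos (x \<bullet> w) \<partial>lborel) = (\<integral>x. - (f (x + - h) * cos ((x + - h) \<bullet> w)) \<partial>lborel)"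
      by (simp add: inner_diff_left hw)
    then show ?thesis
      using lborel_integral_translation[of "\<lambda>x. f x * cos (x \<bullet> w)" "- h"] by (simp add: I_def)
  qed
  have i: "integrable lborel (\<lambda>x. f (x + h) * cos (x \<bullet> w))"
    "integrable lborel (\<lambda>x. f (x - h) * cos (x \<bullet> w))" "integrable lborel (\<lambda>x. f x * cos (x \<bullet> w))"
    using int[of h] int[of "- h"] int[of 0] by simp_all
  have "(\<integral>x. (f (x + h) + f (x - h) - 2 * f x) * cos (x \<bullet> w) \<partial>lborel)
    = (\<integral>x. f (x + h) * cos (x \<bullet> w) + f (x - h) * cos (x \<bullet> w) - 2 * (f x * cos (x \<bullet> w)) \<partial>lborel)"
    by (simp add: algebra_simps)
  also have "\<dots> = - 4 * I"
    using i plus minus by (simp add: I_def)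
  finally have eq: "(\<integral>x. (f (x + h) + f (x - h) - 2 * f x) * cos (x \<bullet> w) \<partial>lborel) = - 4 * I" .
  have D0: "D \<ge> 0" using D[of 0] by linarith
  have "\<bar>(f (x + h) + f (x - h) - 2 * f x) * cos (x \<bullet> w)\<bar> \<le> D" for x
    using mult_mono[OF D[of x] abs_cos_le_one[of "x \<bullet> w"]] D0 by (simp add: abs_mult)
  then have "\<bar>\<integral>x. (f (x + h) + f (x - h) - 2 * f x) * cos (x \<bullet> w) \<partial>lborel\<bar>
      \<le> D * measure lborel (cball (0::'a) (R + norm h))"
    by (rule integrable_bounded_support(2)[rotated])
      (use supp[of _ h] supp[of _ "- h"] supp[of _ 0] in auto)
  then show ?thesis
    unfolding eq by (simp add: I_def abs_mult)
qed

text \<open>The Fourier transform of the squared cut-off at scale 1 / \<open>L\<close>. The cut-off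
  is radial, so the sine part integrates to 0 and the cosine alone remains.\<close>

definition cutoff_kernel :: "(real \<Rightarrow> real) \<Rightarrow> real \<Rightarrow> real ^ 2 \<Rightarrow> real" where
  "cutoff_kernel a L w = (\<integral>x. (a (L * norm x))\<^sup>2 * cos (x \<bullet> w) \<partial>lborel)"

section \<open>Size and decay of the kernel\<close>

lemma disc_area_eq: "r \<ge> 0 \<Longrightarrow> disc_area r = pi * r\<^sup>2"
  using circle_area[of r 0] by (simp add: disc_area_def mult.commute)

lemma measure_cball_eq: "r \<ge> 0 \<Longrightarrow> measure lborel (cball (0 :: real ^ 2) r) = pi * r\<^sup>2"
  using circle_area[of r 0] by (simp add: content_cball_conv_ball mult.commute)

lemma cutoff_square_props:
  assumes "cutoff_function a"
  obtains B where "B \<ge> 0" "\<And>t. (a t)\<^sup>2 \<le> B" "(\<lambda>t. (a t)\<^sup>2) \<in> borel_measurable borel"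
    "\<And>t. \<bar>t\<bar> > 2 \<Longrightarrow> (a t)\<^sup>2 = 0"
proof -
  obtain a1 where d: "\<And>t. (a has_real_derivative a1 t) (at t)" and z: "\<And>t. \<bar>t\<bar> > 2 \<Longrightarrow> a t = 0"
    using cutoff_derivatives[OF assms] by metis
  have cont: "continuous_on UNIV (\<lambda>t. (a t)\<^sup>2)"
    using d by (intro continuous_intros) (meson DERIV_isCont continuous_at_imp_continuous_on)
  obtain B where B: "\<And>t. \<bar>(a t)\<^sup>2\<bar> \<le> B" "B \<ge> 0"
    using continuous_vanishing_bounded[OF cont, of 2] z by auto
  show thesis
    by (rule that[of B]) (use B z cont in \<open>auto intro: borel_measurable_continuous_onI\<close>)
qed

lemma kernel_integrable:
  assumes "cutoff_function a" "L > 0"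
  shows "integrable lborel (\<lambda>x :: real ^ 2. (a (L * norm x))\<^sup>2 * cos (x \<bullet> w))"
proof -
  obtain B where B: "B \<ge> 0" "\<And>t. (a t)\<^sup>2 \<le> B" and [measurable]: "(\<lambda>t. (a t)\<^sup>2) \<in> borel_measurable borel"
    and z: "\<And>t. \<bar>t\<bar> > 2 \<Longrightarrow> (a t)\<^sup>2 = 0"
    using cutoff_square_props[OF assms(1)] by metis
  have "(\<lambda>x :: real ^ 2. (\<lambda>t. (a t)\<^sup>2) (L * norm x) * cos (x \<bullet> w)) \<in> borel_measurable borel"
    by measurable
  then show ?thesis
  proof (rule integrable_bounded_support[where B = B and R = "2 / L"])
    show "\<bar>(a (L * norm x))\<^sup>2 * cos (x \<bullet> w)\<bar> \<le> B" for x :: "real ^ 2"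
      using mult_mono[OF B(2)[of "L * norm x"] abs_cos_le_one[of "x \<bullet> w"]] B(1) by (simp add: abs_mult)
  qed (use z assms(2) in \<open>simp add: field_simps\<close>)
qed

text \<open>At frequency 0 the cosine is 1, and the cut-off equals 1 on the ball of radius 1 /
  \<open>L\<close>. This supplies the lower bound for the expected mass.\<close>

lemma kernel_zero_ge:
  assumes "cutoff_function a" "L > 0"
  shows "disc_area (1 / L) \<le> cutoff_kernel a L 0"
proof -
  have one: "a t = 1" if "\<bar>t\<bar> \<le> 1" for t
    using assms(1) that by (auto simp: cutoff_function_def abs_le_iff)
  have "disc_area (1 / L) = (\<integral>x. indicator (ball (0 :: real ^ 2) (1 / L)) x \<partial>lborel)"
    by (simp add: disc_area_def)
  also have "\<dots> \<le> cutoff_kernel a L 0"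
    unfolding cutoff_kernel_def
  proof (intro integral_mono kernel_integrable assms)
    show "integrable lborel (indicat_real (ball (0 :: real ^ 2) (1 / L)))"
      using emeasure_lborel_ball_finite by (intro integrable_real_indicator) auto
    show "indicator (ball 0 (1 / L)) x \<le> (a (L * norm x))\<^sup>2 * cos (x \<bullet> 0)" for x :: "real ^ 2"
      using one[of "L * norm x"] assms(2) by (auto simp: indicator_def abs_mult field_simps)
  qed
  finally show ?thesis .
qed

text \<open>The area of the support gives a bound of order 1 / L^2, and second differences give one
  of order 1 / |w|^2. The larger of \<open>L\<close> and \<open>norm w\<close> is at least half
  their sum, so the better of the two bounds is the claimed one, with a constant free of
  \<open>L\<close> and \<open>w\<close>.\<close>

lemma kernel_decay:
  assumes a: "cutoff_function a"
  obtains B where "B > 0" "\<And>L w. L > 0 \<Longrightarrow> \<bar>cutoff_kernel a L w\<bar> \<le> B / (L + norm w)\<^sup>2"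
proof -
  obtain B where B: "B \<ge> 0" "\<And>t. (a t)\<^sup>2 \<le> B" and [measurable]: "(\<lambda>t. (a t)\<^sup>2) \<in> borel_measurable borel"
    and z: "\<And>t. \<bar>t\<bar> > 2 \<Longrightarrow> (a t)\<^sup>2 = 0"
    using cutoff_square_props[OF a] by metis
  obtain M where M: "M \<ge> 0" and sd: "\<And>x h :: real ^ 2.
      \<bar>(a (norm (x + h)))\<^sup>2 + (a (norm (x - h)))\<^sup>2 - 2 * (a (norm x))\<^sup>2\<bar> \<le> M * (norm h)\<^sup>2"
    using cutoff_square_second_difference[OF a, where 'a = "real ^ 2"] by metis
  define B1 where "B1 = 4 * pi * B"
  \<comment> \<open>The first summand comes from second differences at high frequency, the second
    from converting the area bound at low frequency.\<close>
  define B2 where "B2 = 9 * pi ^ 3 * M + B1 * pi\<^sup>2"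
  have B1_nonneg: "B1 \<ge> 0" and B2_nonneg: "B2 \<ge> 0"
    using B(1) M by (auto simp: B1_def B2_def)
  have meas: "(\<lambda>x :: real ^ 2. (a (L * norm x))\<^sup>2) \<in> borel_measurable borel" for L
  proof -
    have "(\<lambda>x :: real ^ 2. (\<lambda>t. (a t)\<^sup>2) (L * norm x)) \<in> borel_measurable borel"
      by measurable
    then show ?thesis by simp
  qed
  have supp: "(a (L * norm x))\<^sup>2 = 0" if "L > 0" "norm x > 2 / L" for L and x :: "real ^ 2"
    using z that by (simp add: field_simps)
  have small: "\<bar>cutoff_kernel a L w\<bar> \<le> B1 / L\<^sup>2" if L: "L > 0" for L w
  proof -
    have "\<bar>(a (L * norm x))\<^sup>2 * cos (x \<bullet> w)\<bar> \<le> B" for x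
      using mult_mono[OF B(2)[of "L * norm x"] abs_cos_le_one[of "x \<bullet> w"]] B(1) by (simp add: abs_mult)
    then have "\<bar>cutoff_kernel a L w\<bar> \<le> B * measure lborel (cball (0 :: real ^ 2) (2 / L))"
      unfolding cutoff_kernel_def
      by (rule integrable_bounded_support(2)[rotated]) (use L supp meas in auto)
    also have "\<dots> = B1 / L\<^sup>2"
      using L by (subst measure_cball_eq) (auto simp: B1_def power_divide)
    finally show ?thesis .
  qed
  have large: "\<bar>cutoff_kernel a L w\<bar> \<le> B2 / (norm w)\<^sup>2" if L: "L > 0" and w: "w \<noteq> 0" for L w
  \<comment> \<open>In the first case the shift has length at most 4 / \<open>L\<close>, so the
    enlarged ball has radius at most 6 / \<open>L\<close>. In the other case \<open>norm w\<close>
    is at most a multiple of \<open>L\<close> and the area bound is already good enough.\<close>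
  proof (cases "pi * L \<le> 4 * norm w")
    case True
    define h where "h = (pi / (norm w)\<^sup>2) *\<^sub>R w"
    have nh: "norm h = pi / norm w"
      using w by (simp add: h_def power2_eq_square)
    have second: "\<bar>(a (L * norm (x + h)))\<^sup>2 + (a (L * norm (x - h)))\<^sup>2 - 2 * (a (L * norm x))\<^sup>2\<bar>
        \<le> M * (L * norm h)\<^sup>2" for x
      using sd[of "L *\<^sub>R x" "L *\<^sub>R h"] L
      by (simp flip: scaleR_add_right scaleR_diff_right)
    have "\<bar>cutoff_kernel a L w\<bar> \<le> M * (L * norm h)\<^sup>2 / 4 * measure lborel (cball (0 :: real ^ 2) (2 / L + norm h))"
      unfolding cutoff_kernel_def h_def
      by (rule cosine_transform_bound[where B = B, OF meas _ supp[OF L] w second[unfolded h_def]])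
        (simp add: B(2))
    also have "\<dots> \<le> M * (L * norm h)\<^sup>2 / 4 * (pi * (6 / L)\<^sup>2)"
    proof -
      have "2 / L + norm h \<le> 6 / L"
        using True L w by (simp add: nh field_simps)
      then have "(2 / L + norm h)\<^sup>2 \<le> (6 / L)\<^sup>2"
        using L by (intro power_mono) auto
      moreover have "2 / L + norm h \<ge> 0" using L by auto
      ultimately show ?thesis
        using M by (subst measure_cball_eq) (auto intro!: mult_left_mono)
    qed
    also have "\<dots> = 9 * pi ^ 3 * M / (norm w)\<^sup>2"
      using L w by (simp add: nh field_simps power2_eq_square power3_eq_cube)
    also have "\<dots> \<le> B2 / (norm w)\<^sup>2"
      using B1_nonneg by (intro divide_right_mono) (auto simp: B2_def)
    finally show ?thesis .
  next
    case False
    then have "norm w \<le> pi * L"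
      using norm_ge_zero[of w] by linarith
    then have "(norm w)\<^sup>2 \<le> (pi * L)\<^sup>2"
      by (intro power_mono) auto
    then have "B1 * (norm w)\<^sup>2 \<le> B1 * (pi\<^sup>2 * L\<^sup>2)"
      using B1_nonneg by (intro mult_left_mono) (auto simp: power_mult_distrib)
    then have "B1 / L\<^sup>2 \<le> B1 * pi\<^sup>2 / (norm w)\<^sup>2"
      using L w by (simp add: field_simps)
    also have "\<dots> \<le> B2 / (norm w)\<^sup>2"
      using M by (intro divide_right_mono) (auto simp: B2_def)
    finally show ?thesis
      using small[OF L, of w] by linarith
  qed
  \<comment> \<open>The factor 4 pays for replacing the maximum by the sum; the summand 1 makes the
    constant strictly positive.\<close>
  have "\<bar>cutoff_kernel a L w\<bar> \<le> (4 * (B1 + B2) + 1) / (L + norm w)\<^sup>2" if L: "L > 0" for L w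
  proof -
    define m where "m = max L (norm w)"
    have m: "m > 0" using L by (auto simp: m_def)
    have "\<bar>cutoff_kernel a L w\<bar> \<le> (B1 + B2) / m\<^sup>2"
    proof (cases "norm w \<le> L")
      case True
      then have "B1 / L\<^sup>2 \<le> (B1 + B2) / m\<^sup>2"
        using B2_nonneg by (auto simp: m_def max_def intro!: divide_right_mono)
      then show ?thesis using small[OF L, of w] by linarith
    next
      case False
      then have "w \<noteq> 0" "m = norm w" using L by (auto simp: m_def)
      moreover have "B2 / m\<^sup>2 \<le> (B1 + B2) / m\<^sup>2"
        using B1_nonneg by (auto intro!: divide_right_mono)
      ultimately show ?thesis using large[OF L, of w] by force
    qed
    also have "\<dots> = 4 * (B1 + B2) / (2 * m)\<^sup>2"
      using m by (simp add: power_mult_distrib field_simps)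
    also have "\<dots> \<le> (4 * (B1 + B2) + 1) / (L + norm w)\<^sup>2"
    proof -
      have "L + norm w \<le> 2 * m" by (auto simp: m_def)
      moreover have "L + norm w > 0" using L by (simp add: add_pos_nonneg)
      ultimately show ?thesis
        using B1_nonneg B2_nonneg by (intro frac_le power_mono) auto
    qed
    finally show ?thesis .
  qed
  then show thesis
    using that[of "4 * (B1 + B2) + 1"] B1_nonneg B2_nonneg by simp
qed

section \<open>Equally spaced points on the circle\<close>

text \<open>Each term after the first is at most a difference 1 / y - 1 / (y + 1), and these
  telescope. The induction keeps the last term of the telescoping sum, which is dropped at the
  end.\<close>

lemma sum_inverse_square_shift_le:
  fixes T :: real
  assumes "T > 0"
  shows "(\<Sum>m\<le>n. 1 / (T + real m)\<^sup>2) \<le> 1 / T\<^sup>2 + 1 / T"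
proof -
  have "(\<Sum>m\<le>n. 1 / (T + real m)\<^sup>2) \<le> 1 / T\<^sup>2 + 1 / T - 1 / (T + real n)"
  proof (induction n)
    case (Suc n)
    define y where "y = T + real n"
    have y: "y > 0" using assms by (simp add: y_def)
    have "1 / (y + 1)\<^sup>2 \<le> 1 / (y * (y + 1))"
      using y by (intro frac_le) (auto simp: power2_eq_square)
    also have "\<dots> = 1 / y - 1 / (y + 1)"
      using y by (simp add: field_simps)
    finally show ?case
      using Suc by (simp add: y_def add_ac)
  qed simp
  moreover have "1 / (T + real n) \<ge> 0" using assms by simp
  ultimately show ?thesis by linarith
qed

lemma sum_compose_inj_le:
  fixes f :: "nat \<Rightarrow> real"
  assumes "inj_on \<phi> A" "\<phi> ` A \<subseteq> {..n}" "\<And>m. f m \<ge> 0"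
  shows "(\<Sum>k\<in>A. f (\<phi> k)) \<le> (\<Sum>m\<le>n. f m)"
  using assms by (simp add: sum.reindex[OF assms(1), symmetric, unfolded comp_def] sum_mono2)

text \<open>The distance of two indices around a cycle of length \<open>N\<close> is their
  difference or its complement in \<open>N\<close>. Adding both candidates avoids deciding which one
  is smaller. On either side of \<open>j\<close> both index maps are injective into
  \<open>{..N}\<close>, which makes four sums in all.\<close>

lemma sum_circular_distance_le:
  fixes f g :: "nat \<Rightarrow> real"
  assumes j: "j \<in> {1..N}" and f: "\<And>m. f m \<ge> 0"
    and le: "\<And>k. k \<in> {1..N} \<Longrightarrow> k \<le> j \<Longrightarrow> g k \<le> f (j - k) + f (N - (j - k))"
    and ge: "\<And>k. k \<in> {1..N} \<Longrightarrow> k > j \<Longrightarrow> g k \<le> f (k - j) + f (N - (k - j))"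
  shows "(\<Sum>k=1..N. g k) \<le> 4 * (\<Sum>m\<le>N. f m)"
proof -
  have split: "{1..N} = {1..j} \<union> {j<..N}" using j by auto
  have "(\<Sum>k=1..N. g k) = (\<Sum>k\<in>{1..j}. g k) + (\<Sum>k\<in>{j<..N}. g k)"
    unfolding split by (rule sum.union_disjoint) auto
  also have "\<dots> \<le> (\<Sum>k\<in>{1..j}. f (j - k) + f (N - (j - k))) + (\<Sum>k\<in>{j<..N}. f (k - j) + f (N - (k - j)))"
    using j by (intro add_mono sum_mono le ge) auto
  also have "\<dots> \<le> 4 * (\<Sum>m\<le>N. f m)"
  proof -
    have "(\<Sum>k\<in>{1..j}. f (j - k)) \<le> (\<Sum>m\<le>N. f m)" "(\<Sum>k\<in>{1..j}. f (N - (j - k))) \<le> (\<Sum>m\<le>N. f m)"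
      "(\<Sum>k\<in>{j<..N}. f (k - j)) \<le> (\<Sum>m\<le>N. f m)" "(\<Sum>k\<in>{j<..N}. f (N - (k - j))) \<le> (\<Sum>m\<le>N. f m)"
      using j by (intro sum_compose_inj_le f; force simp: inj_on_def)+
    then show ?thesis by (simp add: sum.distrib)
  qed
  finally show ?thesis .
qed

section \<open>Chord lengths between equally spaced points\<close>

lemma sin_ge_third:
  fixes x :: real
  assumes "0 \<le> x" "x \<le> 2"
  shows "x / 3 \<le> sin x"
proof -
  have "\<bar>sin x - (\<Sum>m<3. sin_coeff m * x ^ m)\<bar> \<le> inverse (fact 3) * \<bar>x\<bar> ^ 3"
    by (rule Maclaurin_sin_bound)
  then have "sin x \<ge> x - x ^ 3 / 6"
    using assms by (simp add: eval_nat_numeral sin_coeff_def abs_if split: if_splits)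
  \<comment> \<open>On [0, 2] the cubic term is thus at most two thirds of \<open>x\<close>, which
    leaves one third.\<close>
  moreover have "x ^ 3 \<le> 4 * x"
    using mult_right_mono[OF power_mono[OF assms(2,1), of 2] assms(1)]
    by (simp add: power2_eq_square power3_eq_cube)
  ultimately show ?thesis by linarith
qed

text \<open>The hypothesis keeps the angle below pi / 2, hence in the range of the linear bound for
  the sine; the slope 1 / 3 is absorbed by pi > 3.\<close>

lemma sin_pi_fraction_ge:
  assumes "2 * m \<le> N" "N > 0"
  shows "real m / real N \<le> sin (pi * real m / real N)"
proof -
  have "pi * real m / real N \<le> pi / 2"
    using assms by (simp add: field_simps mult_left_mono flip: of_nat_mult)
  also have "\<dots> \<le> 2" using pi_less_4 by simp
  finally have "pi * real m / real N / 3 \<le> sin (pi * real m / real N)"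
    by (intro sin_ge_third) auto
  moreover have "real m / real N \<le> pi * real m / real N / 3"
    using mult_right_mono[of 3 pi "real m / real N"] pi_gt3 by simp
  ultimately show ?thesis by linarith
qed

lemma norm_circle_chord:
  "norm (vector [cos s, sin s] - vector [cos t, sin t] :: real ^ 2) = 2 * \<bar>sin ((s - t) / 2)\<bar>"
proof -
  have "(norm (vector [cos s, sin s] - vector [cos t, sin t] :: real ^ 2))\<^sup>2
      = (cos s - cos t)\<^sup>2 + (sin s - sin t)\<^sup>2"
    unfolding power2_norm_eq_inner inner_vec_def by (simp add: sum_2 power2_eq_square)
  also have "\<dots> = 2 - 2 * cos (s - t)"
    using sin_cos_squared_add[of s] sin_cos_squared_add[of t]
    by (simp add: cos_diff power2_eq_square algebra_simps)
  also have "\<dots> = (2 * \<bar>sin ((s - t) / 2)\<bar>)\<^sup>2"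
  proof -
    have "cos (s - t) = 1 - 2 * (sin ((s - t) / 2))\<^sup>2"
    proof -
      have "s - t = 2 * ((s - t) / 2)" by simp
      then show ?thesis using cos_double_sin by metis
    qed
    then show ?thesis by (simp add: power_mult_distrib)
  qed
  finally show ?thesis
    by (subst (asm) power2_eq_iff_nonneg) auto
qed

text \<open>The chord is twice the sine of pi d / N with \<open>d = j - k\<close>. The linear lower
  bound holds for angles up to pi / 2; beyond that, reflecting the angle at pi / 2 replaces
  \<open>d\<close> by \<open>N - d\<close>.\<close>

lemma equally_spaced_distance:
  assumes xi: "equally_spaced_directions N \<xi>" and jk: "j \<in> {1..N}" "k \<in> {1..N}" "k \<le> j"
  shows "\<exists>m\<in>{j - k, N - (j - k)}. norm (\<xi> j - \<xi> k) \<ge> 2 * real m / real N"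
proof -
  have N: "N > 0" using jk by auto
  obtain \<theta> where \<theta>: "\<And>i. i \<in> {1..N} \<Longrightarrow>
      \<xi> i = vector [cos (\<theta> + 2 * pi * real i / real N), sin (\<theta> + 2 * pi * real i / real N)]"
    using xi by (auto simp: equally_spaced_directions_def)
  define d where "d = j - k"
  have "norm (\<xi> j - \<xi> k) = 2 * \<bar>sin (((\<theta> + 2 * pi * real j / real N) - (\<theta> + 2 * pi * real k / real N)) / 2)\<bar>"
    unfolding \<theta>[OF jk(1)] \<theta>[OF jk(2)] by (rule norm_circle_chord)
  also have "((\<theta> + 2 * pi * real j / real N) - (\<theta> + 2 * pi * real k / real N)) / 2 = pi * real d / real N"
    using jk(3) by (simp add: d_def of_nat_diff diff_divide_distrib right_diff_distrib)
  finally have eq: "norm (\<xi> j - \<xi> k) = 2 * \<bar>sin (pi * real d / real N)\<bar>" .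
  show ?thesis
  proof (cases "2 * d \<le> N")
    case True
    then show ?thesis
      using sin_pi_fraction_ge[OF True N] eq by (intro bexI[of _ d]) (auto simp: d_def)
  next
    case False
    have dN: "d \<le> N" using jk by (auto simp: d_def)
    then have "pi * real (N - d) / real N = pi - pi * real d / real N"
      using N by (simp add: of_nat_diff field_simps)
    then have "sin (pi * real (N - d) / real N) = sin (pi * real d / real N)"
      by simp
    then have "real (N - d) / real N \<le> sin (pi * real d / real N)"
      using sin_pi_fraction_ge[of "N - d" N] N False by simp
    then have "2 * real (N - d) / real N \<le> norm (\<xi> j - \<xi> k)"
      unfolding eq times_divide_eq_right[symmetric] by linarith
    then show ?thesis
      unfolding d_def by blast
  qed
qed

section \<open>Quadratic forms in independent signs\<close>

context prob_space
begin

lemma integrable_bounded: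
  fixes f :: "'a \<Rightarrow> real"
  assumes "f \<in> borel_measurable M" "\<And>\<omega>. \<omega> \<in> space M \<Longrightarrow> \<bar>f \<omega>\<bar> \<le> B"
  shows "integrable M f" "\<bar>expectation f\<bar> \<le> B"
proof -
  show f: "integrable M f"
    by (rule integrable_const_bound[where B = B]) (use assms in auto)
  have "\<bar>expectation f\<bar> \<le> expectation (\<lambda>\<omega>. \<bar>f \<omega>\<bar>)"
    by (rule integral_abs_bound)
  also have "\<dots> \<le> expectation (\<lambda>_. B)"
    by (intro integral_mono integrable_abs f) (use assms(2) in auto)
  finally show "\<bar>expectation f\<bar> \<le> B"
    by (simp add: prob_space)
qed

text \<open>By independence the expectation of a monomial factorises, and the factor of exponent 1
  has mean 0.\<close>

lemma expectation_prod_powers_zero: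
  fixes Y :: "'i \<Rightarrow> 'a \<Rightarrow> real"
  assumes ind: "indep_vars (\<lambda>_. borel) Y I" and fin: "finite I"
    and bnd: "\<And>i \<omega>. i \<in> I \<Longrightarrow> \<omega> \<in> space M \<Longrightarrow> \<bar>Y i \<omega>\<bar> \<le> B"
    and j: "j \<in> I" "n j = 1" "expectation (Y j) = 0"
  shows "expectation (\<lambda>\<omega>. \<Prod>i\<in>I. Y i \<omega> ^ n i) = 0"
proof -
  have rv: "Y i \<in> borel_measurable M" if "i \<in> I" for i
    using ind that by (auto simp: indep_vars_def)
  have ind': "indep_vars (\<lambda>_. borel) (\<lambda>i \<omega>. Y i \<omega> ^ n i) I"
    by (rule indep_vars_compose2[OF ind]) auto
  have int: "integrable M (\<lambda>\<omega>. Y i \<omega> ^ n i)" if "i \<in> I" for i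
    by (rule integrable_bounded[where B = "B ^ n i"])
      (use rv[OF that] bnd[OF that] in \<open>auto simp: power_abs power_mono\<close>)
  have "expectation (\<lambda>\<omega>. \<Prod>i\<in>I. Y i \<omega> ^ n i) = (\<Prod>i\<in>I. expectation (\<lambda>\<omega>. Y i \<omega> ^ n i))"
    by (rule indep_vars_lebesgue_integral[OF fin ind' int])
  also have "\<dots> = 0"
    using j fin by (intro prod_zero bexI[of _ j]) auto
  finally show ?thesis .
qed

context
  fixes Y :: "'i \<Rightarrow> 'a \<Rightarrow> real" and I and B :: real
  assumes ind: "indep_vars (\<lambda>_. borel) Y I" and fin: "finite I"
    and bnd: "\<And>i \<omega>. i \<in> I \<Longrightarrow> \<omega> \<in> space M \<Longrightarrow> \<bar>Y i \<omega>\<bar> \<le> B"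
    and centred: "\<And>i. i \<in> I \<Longrightarrow> expectation (Y i) = 0"
begin

lemma centred_measurable: "i \<in> I \<Longrightarrow> Y i \<in> borel_measurable M"
  using ind by (auto simp: indep_vars_def)

lemma expectation_two_zero:
  assumes "j \<in> I" "k \<in> I" "j \<noteq> k"
  shows "expectation (\<lambda>\<omega>. Y j \<omega> * Y k \<omega>) = 0"
proof -
  have "(\<Prod>i\<in>I. Y i \<omega> ^ (of_bool (i = j) + of_bool (i = k))) = Y j \<omega> * Y k \<omega>" for \<omega>
    using assms fin by (simp add: power_add prod.distrib of_bool_def if_distrib[of "power _"] prod.delta cong: if_cong)
  moreover have "expectation (\<lambda>\<omega>. \<Prod>i\<in>I. Y i \<omega> ^ (of_bool (i = j) + of_bool (i = k))) = 0"
    by (rule expectation_prod_powers_zero[where B = B and j = j]) (use ind fin bnd centred assms in auto)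
  ultimately show ?thesis by simp
qed

text \<open>The product is a monomial in which the exponent of \<open>Y i\<close> counts the
  occurrences of \<open>i\<close> among the four indices. Coincidences among \<open>k\<close>,
  \<open>l\<close>, \<open>m\<close> are therefore allowed; only \<open>j\<close> has to occur
  exactly once.\<close>

lemma expectation_four_zero:
  assumes "j \<in> I" "k \<in> I" "l \<in> I" "m \<in> I" "j \<notin> {k, l, m}"
  shows "expectation (\<lambda>\<omega>. Y j \<omega> * Y k \<omega> * (Y l \<omega> * Y m \<omega>)) = 0"
proof -
  have "(\<Prod>i\<in>I. Y i \<omega> ^ ((of_bool (i = j) + of_bool (i = k)) + (of_bool (i = l) + of_bool (i = m))))
      = Y j \<omega> * Y k \<omega> * (Y l \<omega> * Y m \<omega>)" for \<omega>
    using assms fin by (simp add: power_add prod.distrib of_bool_def if_distrib[of "power _"] prod.delta cong: if_cong)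
  moreover have "expectation (\<lambda>\<omega>. \<Prod>i\<in>I. Y i \<omega> ^
      ((of_bool (i = j) + of_bool (i = k)) + (of_bool (i = l) + of_bool (i = m)))) = 0"
    by (rule expectation_prod_powers_zero[where B = B and j = j]) (use ind fin bnd centred assms in auto)
  ultimately show ?thesis by simp
qed

lemma two_bounded:
  assumes "j \<in> I" "k \<in> I" "\<omega> \<in> space M"
  shows "\<bar>Y j \<omega> * Y k \<omega>\<bar> \<le> B\<^sup>2"
  using mult_mono[OF bnd[OF assms(1,3)] bnd[OF assms(2,3)]] bnd[OF assms(1,3)]
  by (simp add: abs_mult power2_eq_square)

lemma two_integrable:
  assumes "j \<in> I" "k \<in> I"
  shows "integrable M (\<lambda>\<omega>. Y j \<omega> * Y k \<omega>)"
  by (rule integrable_bounded(1)[OF _ two_bounded]) (use assms in \<open>auto intro!: borel_measurable_times centred_measurable\<close>)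

lemma four_bounded:
  assumes "j \<in> I" "k \<in> I" "l \<in> I" "m \<in> I" "\<omega> \<in> space M"
  shows "\<bar>Y j \<omega> * Y k \<omega> * (Y l \<omega> * Y m \<omega>)\<bar> \<le> B ^ 4"
proof -
  have "\<bar>Y j \<omega> * Y k \<omega>\<bar> * \<bar>Y l \<omega> * Y m \<omega>\<bar> \<le> B\<^sup>2 * B\<^sup>2"
    using two_bounded assms by (intro mult_mono) auto
  then show ?thesis
    by (simp add: abs_mult flip: power_add)
qed

lemma four_integrable:
  assumes "j \<in> I" "k \<in> I" "l \<in> I" "m \<in> I"
  shows "integrable M (\<lambda>\<omega>. Y j \<omega> * Y k \<omega> * (Y l \<omega> * Y m \<omega>))"
  by (rule integrable_bounded(1)[OF _ four_bounded]) (use assms in \<open>auto intro!: borel_measurable_times centred_measurable\<close>)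

text \<open>Only the pairs with equal indices survive in the expanded square.\<close>

lemma expectation_linear_form_square_le:
  "expectation (\<lambda>\<omega>. (\<Sum>j\<in>I. s j * Y j \<omega>)\<^sup>2) \<le> B\<^sup>2 * (\<Sum>j\<in>I. (s j)\<^sup>2)"
proof -
  have "expectation (\<lambda>\<omega>. (\<Sum>j\<in>I. s j * Y j \<omega>)\<^sup>2)
      = expectation (\<lambda>\<omega>. \<Sum>j\<in>I. \<Sum>k\<in>I. s j * s k * (Y j \<omega> * Y k \<omega>))"
    by (simp add: power2_eq_square sum_product mult_ac)
  also have "\<dots> = (\<Sum>j\<in>I. \<Sum>k\<in>I. s j * s k * expectation (\<lambda>\<omega>. Y j \<omega> * Y k \<omega>))"
    by (simp add: Bochner_Integration.integral_sum two_integrable)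
  also have "\<dots> \<le> (\<Sum>j\<in>I. \<Sum>k\<in>I. if k = j then B\<^sup>2 * (s j)\<^sup>2 else 0)"
  proof (intro sum_mono)
    fix j k assume jk: "j \<in> I" "k \<in> I"
    show "s j * s k * expectation (\<lambda>\<omega>. Y j \<omega> * Y k \<omega>) \<le> (if k = j then B\<^sup>2 * (s j)\<^sup>2 else 0)"
    proof (cases "k = j")
      case True
      have "expectation (\<lambda>\<omega>. Y j \<omega> * Y j \<omega>) \<le> B\<^sup>2"
        using integrable_bounded(2)[OF _ two_bounded[OF jk(1) jk(1)]] jk centred_measurable[OF jk(1)] by auto
      then have "(s j)\<^sup>2 * expectation (\<lambda>\<omega>. Y j \<omega> * Y j \<omega>) \<le> (s j)\<^sup>2 * B\<^sup>2"
        by (rule mult_left_mono) auto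
      then show ?thesis using True by (simp add: power2_eq_square mult_ac)
    qed (use expectation_two_zero jk in simp)
  qed
  also have "\<dots> = B\<^sup>2 * (\<Sum>j\<in>I. (s j)\<^sup>2)"
    using fin by (simp add: sum_distrib_left)
  finally show ?thesis .
qed

text \<open>With a zero diagonal, a product of two coefficients can be nonzero only for
  \<open>j \<noteq> k\<close> and \<open>l \<noteq> m\<close>. Then either (l, m) is (j, k) in one
  of its two orders, or one of \<open>j\<close>, \<open>k\<close> occurs just once and the fourth
  moment vanishes. The two orders give the factor 2.\<close>

lemma expectation_quadratic_form_square_le:
  assumes sym: "\<And>j k. h j k = h k j" and diag: "\<And>j. h j j = 0"
  shows "expectation (\<lambda>\<omega>. (\<Sum>j\<in>I. \<Sum>k\<in>I. h j k * (Y j \<omega> * Y k \<omega>))\<^sup>2)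
    \<le> 2 * B ^ 4 * (\<Sum>j\<in>I. \<Sum>k\<in>I. (h j k)\<^sup>2)"
proof -
  define E where "E j k l m = expectation (\<lambda>\<omega>. Y j \<omega> * Y k \<omega> * (Y l \<omega> * Y m \<omega>))" for j k l m
  let ?h = "\<lambda>(j, k). h j k" and ?Y = "\<lambda>(j, k) \<omega>. Y j \<omega> * Y k \<omega>"
  have "expectation (\<lambda>\<omega>. (\<Sum>j\<in>I. \<Sum>k\<in>I. h j k * (Y j \<omega> * Y k \<omega>))\<^sup>2)
      = expectation (\<lambda>\<omega>. \<Sum>u\<in>I \<times> I. \<Sum>v\<in>I \<times> I. ?h u * ?h v * (?Y u \<omega> * ?Y v \<omega>))"
    by (simp add: sum.cartesian_product power2_eq_square sum_product split_def mult_ac)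
  also have "\<dots> = (\<Sum>u\<in>I \<times> I. \<Sum>v\<in>I \<times> I. ?h u * ?h v * expectation (\<lambda>\<omega>. ?Y u \<omega> * ?Y v \<omega>))"
    by (subst Bochner_Integration.integral_sum
        | auto intro!: Bochner_Integration.integrable_sum integrable_mult_right four_integrable sum.cong)+
  also have "\<dots> \<le> (\<Sum>u\<in>I \<times> I. \<Sum>v\<in>I \<times> I.
      (if v = u then B ^ 4 * (?h u)\<^sup>2 else 0) + (if v = prod.swap u then B ^ 4 * (?h u)\<^sup>2 else 0))"
  proof (intro sum_mono, clarify)
    fix j k l m assume I: "j \<in> I" "k \<in> I" "l \<in> I" "m \<in> I"
    have pos: "B ^ 4 * (h j k)\<^sup>2 \<ge> 0"
      by simp
    have "\<bar>E j k l m\<bar> \<le> B ^ 4"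
      unfolding E_def using I four_bounded[OF I]
      by (intro integrable_bounded(2)) (auto intro!: borel_measurable_times centred_measurable)
    then have le: "(h j k)\<^sup>2 * E j k l m \<le> B ^ 4 * (h j k)\<^sup>2"
      using mult_right_mono[of "E j k l m" "B ^ 4" "(h j k)\<^sup>2"] by (simp add: mult.commute)
    have "h j k * h l m * E j k l m \<le>
      (if (l, m) = (j, k) then B ^ 4 * (h j k)\<^sup>2 else 0) + (if (l, m) = (k, j) then B ^ 4 * (h j k)\<^sup>2 else 0)"
    proof (cases "(l, m) = (j, k) \<or> (l, m) = (k, j)")
      case True
      then have "h j k * h l m * E j k l m = (h j k)\<^sup>2 * E j k l m"
        using sym by (auto simp: power2_eq_square)
      then show ?thesis using True le pos by (smt (verit))
    next
      case False
      have z: "h j k * h l m * E j k l m = 0"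
      proof (cases "j = k \<or> l = m")
        case False2: False
        then have "j \<notin> {k, l, m} \<or> k \<notin> {j, l, m}"
          using False by auto
        moreover have "E j k l m = E k j l m"
          by (simp add: E_def mult.commute[of "Y j _"])
        ultimately have "E j k l m = 0"
          using expectation_four_zero[OF I] expectation_four_zero[OF I(2,1,3,4)] unfolding E_def by metis
        then show ?thesis by simp
      qed (use diag in auto)
      have "(l, m) \<noteq> (j, k)" "(l, m) \<noteq> (k, j)" using False by blast+
      then show ?thesis unfolding z by (simp only: if_False)
    qed
    then show "h j k * h l m * expectation (\<lambda>\<omega>. Y j \<omega> * Y k \<omega> * (Y l \<omega> * Y m \<omega>)) \<le>
      (if (l, m) = (j, k) then B ^ 4 * (h j k)\<^sup>2 else 0)
        + (if (l, m) = prod.swap (j, k) then B ^ 4 * (h j k)\<^sup>2 else 0)"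
      by (simp add: E_def)
  qed
  also have "\<dots> = (\<Sum>u\<in>I \<times> I. 2 * B ^ 4 * (?h u)\<^sup>2)"
    using fin by (intro sum.cong) (auto simp: sum.distrib sum.delta)
  also have "\<dots> = 2 * B ^ 4 * (\<Sum>j\<in>I. \<Sum>k\<in>I. (h j k)\<^sup>2)"
    by (simp add: sum.cartesian_product sum_distrib_left split_def)
  finally show ?thesis .
qed

end

text \<open>Since a sign squares to 1, the diagonal is deterministic. Off the diagonal
  \<open>Z\<close> is replaced by \<open>q + Y\<close> with \<open>Y\<close> centred: the constant
  terms give the expectation, and the two linear terms combine into one linear form whose weights
  are the row sums of \<open>h\<close>.\<close>

lemma sign_quadratic_form_moments:
  fixes Z :: "'i \<Rightarrow> 'a \<Rightarrow> real" and g :: "'i \<Rightarrow> 'i \<Rightarrow> real"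
  assumes ind: "indep_vars (\<lambda>_. borel) Z I" and fin: "finite I"
    and sign: "\<And>i \<omega>. i \<in> I \<Longrightarrow> Z i \<omega> = 1 \<or> Z i \<omega> = -1"
    and mean: "\<And>i. i \<in> I \<Longrightarrow> expectation (Z i) = q"
    and q: "\<bar>q\<bar> \<le> 1"
    and sym: "\<And>j k. g j k = g k j"
  defines "h \<equiv> \<lambda>j k. if j = k then 0 else g j k"
  defines "Q \<equiv> \<lambda>\<omega>. \<Sum>j\<in>I. \<Sum>k\<in>I. Z j \<omega> * Z k \<omega> * g j k"
  shows "expectation Q = (\<Sum>j\<in>I. g j j) + q\<^sup>2 * (\<Sum>j\<in>I. \<Sum>k\<in>I. h j k)"
    and "variance Q \<le> 32 * q\<^sup>2 * (\<Sum>j\<in>I. (\<Sum>k\<in>I. h j k)\<^sup>2) + 64 * (\<Sum>j\<in>I. \<Sum>k\<in>I. (h j k)\<^sup>2)"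
proof -
  define Y where "Y i \<omega> = Z i \<omega> - q" for i \<omega>
  define S where "S j = (\<Sum>k\<in>I. h j k)" for j
  define Lin where "Lin \<omega> = (\<Sum>j\<in>I. S j * Y j \<omega>)" for \<omega>
  define R where "R \<omega> = (\<Sum>j\<in>I. \<Sum>k\<in>I. h j k * (Y j \<omega> * Y k \<omega>))" for \<omega>
  define c where "c = (\<Sum>j\<in>I. g j j) + q\<^sup>2 * (\<Sum>j\<in>I. \<Sum>k\<in>I. h j k)"
  have Z: "Z i \<in> borel_measurable M" "integrable M (Z i)" if "i \<in> I" for i
  proof -
    show "Z i \<in> borel_measurable M"
      using ind that by (auto simp: indep_vars_def)
    then show "integrable M (Z i)"
    proof (rule integrable_bounded[where B = 1])
      show "\<bar>Z i \<omega>\<bar> \<le> 1" for \<omega>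
        using sign[OF that, of \<omega>] by auto
    qed
  qed
  have indY: "indep_vars (\<lambda>_. borel) Y I"
    unfolding Y_def[abs_def] by (rule indep_vars_compose2[OF ind]) auto
  have bndY: "\<bar>Y i \<omega>\<bar> \<le> 2" if "i \<in> I" for i \<omega>
    using sign[OF that, of \<omega>] q by (auto simp: Y_def)
  have cY: "expectation (Y i) = 0" if "i \<in> I" for i
    using Z[OF that] mean[OF that] by (simp add: Y_def[abs_def] prob_space)
  have intY: "integrable M (Y i)" if "i \<in> I" for i
    using Z[OF that] by (simp add: Y_def[abs_def])
  note ctx = indY fin bndY cY
  have hs: "h j k = h k j" and hd: "h j j = 0" for j k
    using sym by (auto simp: h_def)
  have Q_eq: "Q \<omega> = c + (2 * q * Lin \<omega> + R \<omega>)" for \<omega>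
  proof -
    have "Z j \<omega> * Z k \<omega> * g j k = (if k = j then g j j else 0) +
        (q\<^sup>2 * h j k + q * (h j k * Y j \<omega>) + q * (h k j * Y k \<omega>) + h j k * (Y j \<omega> * Y k \<omega>))"
      if "j \<in> I" "k \<in> I" for j k
    proof (cases "j = k")
      case True
      then have "Z j \<omega> * Z k \<omega> = 1" using sign[OF that(1), of \<omega>] by auto
      then show ?thesis using True by (simp add: h_def)
    next
      case False
      then show ?thesis using sym[of j k] by (simp add: h_def Y_def power2_eq_square algebra_simps)
    qed
    then have "Q \<omega> = (\<Sum>j\<in>I. \<Sum>k\<in>I. (if k = j then g j j else 0) +
        (q\<^sup>2 * h j k + q * (h j k * Y j \<omega>) + q * (h k j * Y k \<omega>) + h j k * (Y j \<omega> * Y k \<omega>)))"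
      unfolding Q_def by (intro sum.cong) auto
    also have "\<dots> = c + (q * (\<Sum>j\<in>I. \<Sum>k\<in>I. h j k * Y j \<omega>) + q * (\<Sum>j\<in>I. \<Sum>k\<in>I. h k j * Y k \<omega>) + R \<omega>)"
      using fin by (simp add: sum.distrib c_def R_def sum_distrib_left)
    also have "(\<Sum>j\<in>I. \<Sum>k\<in>I. h k j * Y k \<omega>) = (\<Sum>j\<in>I. \<Sum>k\<in>I. h j k * Y j \<omega>)"
      by (rule sum.swap)
    also have "(\<Sum>j\<in>I. \<Sum>k\<in>I. h j k * Y j \<omega>) = Lin \<omega>"
      by (simp add: Lin_def S_def sum_distrib_right)
    finally show ?thesis by simp
  qed
  have intLin: "integrable M Lin"
    unfolding Lin_def[abs_def] using intY by auto
  have intR: "integrable M R"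
    unfolding R_def[abs_def]
    by (intro Bochner_Integration.integrable_sum integrable_mult_right two_integrable[OF ctx]) auto
  have "expectation Lin = 0"
    unfolding Lin_def[abs_def] using intY cY by (simp add: Bochner_Integration.integral_sum)
  moreover have "expectation R = 0"
  proof -
    have "expectation R = (\<Sum>j\<in>I. \<Sum>k\<in>I. h j k * expectation (\<lambda>\<omega>. Y j \<omega> * Y k \<omega>))"
      unfolding R_def[abs_def]
      by (subst Bochner_Integration.integral_sum
          | auto intro!: Bochner_Integration.integrable_sum integrable_mult_right two_integrable[OF ctx] sum.cong)+
    also have "\<dots> = 0"
      using expectation_two_zero[OF ctx] hd by (intro sum.neutral ballI) (metis mult_zero_left mult_zero_right)
    finally show ?thesis .
  qed
  ultimately have EQ: "expectation Q = c"
    unfolding Q_eq[abs_def] using intLin intR by (simp add: prob_space)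
  then show "expectation Q = (\<Sum>j\<in>I. g j j) + q\<^sup>2 * (\<Sum>j\<in>I. \<Sum>k\<in>I. h j k)"
    by (simp add: c_def)
  have sq_int: "integrable M (\<lambda>\<omega>. (Lin \<omega>)\<^sup>2)" "integrable M (\<lambda>\<omega>. (R \<omega>)\<^sup>2)"
  proof -
    have "\<bar>Lin \<omega>\<bar> \<le> (\<Sum>j\<in>I. \<bar>S j\<bar> * 2)" for \<omega>
      unfolding Lin_def using bndY by (intro order_trans[OF sum_abs] sum_mono) (auto simp: abs_mult intro!: mult_left_mono)
    then have "\<bar>(Lin \<omega>)\<^sup>2\<bar> \<le> (\<Sum>j\<in>I. \<bar>S j\<bar> * 2)\<^sup>2" for \<omega>
      using power_mono[OF _ abs_ge_zero, of "Lin \<omega>" _ 2] by simp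
    then show "integrable M (\<lambda>\<omega>. (Lin \<omega>)\<^sup>2)"
      using intLin by (intro integrable_bounded) auto
    have "\<bar>R \<omega>\<bar> \<le> (\<Sum>j\<in>I. \<Sum>k\<in>I. \<bar>h j k\<bar> * 2\<^sup>2)" if "\<omega> \<in> space M" for \<omega>
      unfolding R_def using two_bounded[OF ctx _ _ that]
      by (intro order_trans[OF sum_abs] sum_mono) (simp add: abs_mult[of "h _ _"] mult_left_mono)
    then have "\<bar>(R \<omega>)\<^sup>2\<bar> \<le> (\<Sum>j\<in>I. \<Sum>k\<in>I. \<bar>h j k\<bar> * 2\<^sup>2)\<^sup>2" if "\<omega> \<in> space M" for \<omega>
      using that power_mono[OF _ abs_ge_zero, of "R \<omega>" _ 2] by simp
    then show "integrable M (\<lambda>\<omega>. (R \<omega>)\<^sup>2)"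
      using intR by (intro integrable_bounded) auto
  qed
  have "variance Q = expectation (\<lambda>\<omega>. (2 * q * Lin \<omega> + R \<omega>)\<^sup>2)"
    unfolding EQ by (simp add: Q_eq)
  \<comment> \<open>The elementary bound (x + y)^2 \<le> 2 x^2 + 2 y^2 avoids the covariance of the
    linear and the quadratic part.\<close>
  also have "\<dots> \<le> expectation (\<lambda>\<omega>. 8 * q\<^sup>2 * (Lin \<omega>)\<^sup>2 + 2 * (R \<omega>)\<^sup>2)"
  proof (intro integral_mono')
    show "(2 * q * Lin \<omega> + R \<omega>)\<^sup>2 \<le> 8 * q\<^sup>2 * (Lin \<omega>)\<^sup>2 + 2 * (R \<omega>)\<^sup>2" for \<omega>
      using zero_le_power2[of "2 * q * Lin \<omega> - R \<omega>"] by (simp add: power2_eq_square algebra_simps)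
  qed (use sq_int in auto)
  also have "\<dots> = 8 * q\<^sup>2 * expectation (\<lambda>\<omega>. (Lin \<omega>)\<^sup>2) + 2 * expectation (\<lambda>\<omega>. (R \<omega>)\<^sup>2)"
    using sq_int by simp
  \<comment> \<open>The powers of 2 come from the bound 2 for the centred signs.\<close>
  also have "\<dots> \<le> 8 * q\<^sup>2 * (2\<^sup>2 * (\<Sum>j\<in>I. (S j)\<^sup>2)) + 2 * (2 * 2 ^ 4 * (\<Sum>j\<in>I. \<Sum>k\<in>I. (h j k)\<^sup>2))"
    unfolding Lin_def R_def
    by (intro add_mono mult_left_mono expectation_linear_form_square_le[OF ctx]
        expectation_quadratic_form_square_le[OF ctx hs hd]) auto
  finally show "variance Q \<le> 32 * q\<^sup>2 * (\<Sum>j\<in>I. (\<Sum>k\<in>I. h j k)\<^sup>2) + 64 * (\<Sum>j\<in>I. \<Sum>k\<in>I. (h j k)\<^sup>2)"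
    by (simp add: S_def)
qed

end

section \<open>Moments of the local mass\<close>

text \<open>The variables \<open>X j\<close> are signs only almost surely. They are replaced by
  variables that are signs everywhere and agree with them almost surely, which changes neither
  expectation nor variance.\<close>

lemma independent_signs_quadratic_form:
  fixes X :: "nat \<Rightarrow> 'w \<Rightarrow> real" and g :: "nat \<Rightarrow> nat \<Rightarrow> real"
  assumes X: "independent_signs M p N X" and p: "p \<in> {0..1}"
    and sym: "\<And>j k. g j k = g k j"
  defines "h \<equiv> \<lambda>j k. if j = k then 0 else g j k"
  defines "Q \<equiv> \<lambda>\<omega>. \<Sum>j=1..N. \<Sum>k=1..N. X j \<omega> * X k \<omega> * g j k"
  shows "prob_space.expectation M Q = (\<Sum>j=1..N. g j j) + (2 * p - 1)\<^sup>2 * (\<Sum>j=1..N. \<Sum>k=1..N. h j k)"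
    and "prob_space.variance M Q \<le> 32 * (2 * p - 1)\<^sup>2 * (\<Sum>j=1..N. (\<Sum>k=1..N. h j k)\<^sup>2)
      + 64 * (\<Sum>j=1..N. \<Sum>k=1..N. (h j k)\<^sup>2)"
proof -
  interpret prob_space M
    using X by (simp add: independent_signs_def)
  have ind: "indep_vars (\<lambda>_. borel) X {1..N}"
    and pr: "\<And>j. j \<in> {1..N} \<Longrightarrow> prob {\<omega> \<in> space M. X j \<omega> = 1} = p"
      "\<And>j. j \<in> {1..N} \<Longrightarrow> prob {\<omega> \<in> space M. X j \<omega> = -1} = 1 - p"
    using X by (auto simp: independent_signs_def)
  have rv: "X j \<in> borel_measurable M" if "j \<in> {1..N}" for j
    using ind that by (auto simp: indep_vars_def)
  \<comment> \<open>On the null set where \<open>X j\<close> is neither 1 nor -1 the value is set to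
    -1. Being a measurable function of \<open>X j\<close> alone, \<open>Z j\<close> inherits
    independence.\<close>
  define Z where "Z j \<omega> = (if X j \<omega> = 1 then 1 else - 1 :: real)" for j \<omega>
  have Z_ind: "indep_vars (\<lambda>_. borel) Z {1..N}"
    unfolding Z_def[abs_def] by (rule indep_vars_compose2[OF ind]) auto
  have rvZ: "Z j \<in> borel_measurable M" if "j \<in> {1..N}" for j
    using Z_ind that by (auto simp: indep_vars_def)
  have Z_sign: "Z j \<omega> = 1 \<or> Z j \<omega> = -1" for j \<omega>
    by (simp add: Z_def)
  have Z_mean: "expectation (Z j) = 2 * p - 1" if "j \<in> {1..N}" for j
  proof -
    have m: "{\<omega> \<in> space M. X j \<omega> = 1} \<in> sets M"
      using rv[OF that] by measurable
    have "expectation (Z j) = expectation (\<lambda>\<omega>. 2 * indicator {\<omega> \<in> space M. X j \<omega> = 1} \<omega> - 1)"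
      by (intro Bochner_Integration.integral_cong) (auto simp: Z_def indicator_def)
    also have "\<dots> = 2 * p - 1"
    proof -
      have "integrable M (indicat_real {\<omega> \<in> space M. X j \<omega> = 1})"
        using m by (intro integrable_real_indicator) (auto simp: emeasure_finite less_top[symmetric])
      moreover have "expectation (indicat_real {\<omega> \<in> space M. X j \<omega> = 1}) = p"
        using pr(1)[OF that] m by simp
      ultimately show ?thesis by (simp add: prob_space)
    qed
    finally show ?thesis .
  qed
  have ae: "AE \<omega> in M. X j \<omega> = Z j \<omega>" if "j \<in> {1..N}" for j
  proof -
    have m: "{\<omega> \<in> space M. X j \<omega> = 1} \<in> sets M" "{\<omega> \<in> space M. X j \<omega> = -1} \<in> sets M"
      using rv[OF that] by measurable
    have "prob ({\<omega> \<in> space M. X j \<omega> = 1} \<union> {\<omega> \<in> space M. X j \<omega> = -1}) = 1"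
      by (subst finite_measure_Union[OF m]) (use pr[OF that] in auto)
    then have "AE \<omega> in M. \<omega> \<in> {\<omega> \<in> space M. X j \<omega> = 1} \<union> {\<omega> \<in> space M. X j \<omega> = -1}"
      using AE_prob_1 by blast
    then show ?thesis
      by eventually_elim (auto simp: Z_def)
  qed
  define Q' where "Q' \<omega> = (\<Sum>j=1..N. \<Sum>k=1..N. Z j \<omega> * Z k \<omega> * g j k)" for \<omega>
  have Q_meas: "Q \<in> borel_measurable M" "Q' \<in> borel_measurable M"
    unfolding Q_def Q'_def[abs_def]
    by (intro borel_measurable_sum borel_measurable_times rv rvZ; simp)+
  have "AE \<omega> in M. \<forall>j\<in>{1..N}. X j \<omega> = Z j \<omega>"
    using ae by (intro AE_finite_allI) auto
  then have AE_eq: "AE \<omega> in M. Q \<omega> = Q' \<omega>"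
    by eventually_elim (simp add: Q_def Q'_def)
  have E: "expectation Q = expectation Q'"
    by (rule integral_cong_AE[OF Q_meas AE_eq])
  have V: "variance Q = variance Q'"
    unfolding E by (rule integral_cong_AE) (use Q_meas AE_eq in auto)
  have q: "\<bar>2 * p - 1\<bar> \<le> 1" using p by auto
  note moments = sign_quadratic_form_moments[OF Z_ind _ Z_sign Z_mean q sym, folded Q'_def h_def]
  show "expectation Q = (\<Sum>j=1..N. g j j) + (2 * p - 1)\<^sup>2 * (\<Sum>j=1..N. \<Sum>k=1..N. h j k)"
    unfolding E using moments(1) by (simp add: h_def Q'_def[abs_def])
  show "variance Q \<le> 32 * (2 * p - 1)\<^sup>2 * (\<Sum>j=1..N. (\<Sum>k=1..N. h j k)\<^sup>2)
      + 64 * (\<Sum>j=1..N. \<Sum>k=1..N. (h j k)\<^sup>2)"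
    unfolding V using moments(2) by (simp add: h_def Q'_def[abs_def])
qed

section \<open>The local mass as a quadratic form in the coefficients\<close>

lemma cmod_trigonometric_sum:
  fixes s t :: "nat \<Rightarrow> real"
  shows "(cmod (\<Sum>j\<in>I. of_real (s j) * exp (\<i> * of_real (t j))))\<^sup>2
    = (\<Sum>j\<in>I. \<Sum>k\<in>I. s j * s k * cos (t j - t k))"
proof -
  have "(cmod (\<Sum>j\<in>I. of_real (s j) * exp (\<i> * of_real (t j))))\<^sup>2
      = (\<Sum>j\<in>I. s j * cos (t j))\<^sup>2 + (\<Sum>j\<in>I. s j * sin (t j))\<^sup>2"
    by (simp add: cmod_power2 Re_sum Im_sum flip: cis_conv_exp)
  also have "\<dots> = (\<Sum>j\<in>I. \<Sum>k\<in>I. s j * s k * cos (t j - t k))"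
    by (simp add: power2_eq_square sum_product cos_diff algebra_simps flip: sum.distrib)
  finally show ?thesis .
qed

text \<open>Expanding the squared modulus gives a double sum of cosines of phase differences, and
  integrating each against the squared cut-off gives a kernel value. The normalisation squares to 1
  / (\<gamma> lam).\<close>

lemma local_mass_wave:
  assumes a: "cutoff_function a" and pos: "\<gamma> > 0" "lam > 0"
  shows "local_mass a \<alpha> lam (wave \<gamma> lam N \<xi> s)
    = (\<Sum>j=1..N. \<Sum>k=1..N. s j * s k * cutoff_kernel a (lam powr \<alpha>) (lam *\<^sub>R (\<xi> j - \<xi> k))) / (\<gamma> * lam)"
proof -
  define L where "L = lam powr \<alpha>"
  have L: "L > 0" using pos by (simp add: L_def)
  have c: "(\<gamma> powr (-1/2) * lam powr (-1/2))\<^sup>2 = 1 / (\<gamma> * lam)"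
    using pos by (simp add: power_mult_distrib powr_power powr_minus field_simps)
  let ?f = "\<lambda>j k x. (a (L * norm x))\<^sup>2 * cos (x \<bullet> (lam *\<^sub>R (\<xi> j - \<xi> k)))"
  have eq: "(cmod (of_real (scaled_cutoff a \<alpha> lam x) * wave \<gamma> lam N \<xi> s x))\<^sup>2
      = (\<Sum>j=1..N. \<Sum>k=1..N. s j * s k * ?f j k x) / (\<gamma> * lam)" for x
  proof -
    have "(cmod (of_real (scaled_cutoff a \<alpha> lam x) * wave \<gamma> lam N \<xi> s x))\<^sup>2
        = (a (L * norm x))\<^sup>2 * ((\<gamma> powr (-1/2) * lam powr (-1/2))\<^sup>2
          * (cmod (\<Sum>j=1..N. of_real (s j) * exp (\<i> * of_real (lam * (x \<bullet> \<xi> j)))))\<^sup>2)"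
      unfolding wave_def scaled_cutoff_def
      by (simp only: norm_mult norm_of_real power_mult_distrib power2_abs L_def)
    also have "\<dots> = (a (L * norm x))\<^sup>2 * ((1 / (\<gamma> * lam)) *
        (\<Sum>j=1..N. \<Sum>k=1..N. s j * s k * cos (lam * (x \<bullet> \<xi> j) - lam * (x \<bullet> \<xi> k))))"
      by (simp only: c cmod_trigonometric_sum)
    also have "\<dots> = (\<Sum>j=1..N. \<Sum>k=1..N. s j * s k * ?f j k x) / (\<gamma> * lam)"
      by (simp add: sum_distrib_left sum_divide_distrib inner_diff_right right_diff_distrib mult_ac)
    finally show ?thesis .
  qed
  have int: "integrable lborel (?f j k)" for j k
    by (rule kernel_integrable[OF a L])
  have "(\<integral>x. (\<Sum>j=1..N. \<Sum>k=1..N. s j * s k * ?f j k x) \<partial>lborel)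
      = (\<Sum>j=1..N. \<Sum>k=1..N. s j * s k * (\<integral>x. ?f j k x \<partial>lborel))"
    by (subst Bochner_Integration.integral_sum
        | intro Bochner_Integration.integrable_sum integrable_mult_right int sum.cong refl
            integral_mult_right_zero)+
  then show ?thesis
    unfolding local_mass_def L2_norm_sq_def eq by (simp only: integral_divide_zero cutoff_kernel_def L_def)
qed

lemma kernel_minus: "cutoff_kernel a L (- w) = cutoff_kernel a L w"
  by (simp add: cutoff_kernel_def)

text \<open>At circular distance \<open>m\<close> the frequency is at least 2 m / \<gamma>, which is
  weakened to m / \<gamma>; the kernel is then at most \<open>f m\<close>, an inverse square shifted
  by \<open>\<gamma> * L\<close>. As this shift is at least 1, the sum of the inverse squares is at
  most 2 / (\<gamma> L).\<close>

lemma kernel_row_sum_le: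
  assumes B: "B > 0" "\<And>L w. L > 0 \<Longrightarrow> \<bar>cutoff_kernel a L w\<bar> \<le> B / (L + norm w)\<^sup>2"
    and xi: "equally_spaced_directions N \<xi>" and j: "j \<in> {1..N}"
    and pos: "\<gamma> > 0" "lam > 0" "L > 0" and N: "real N = \<gamma> * lam" and T: "\<gamma> * L \<ge> 1"
  shows "(\<Sum>k=1..N. \<bar>cutoff_kernel a L (lam *\<^sub>R (\<xi> j - \<xi> k))\<bar>) \<le> 8 * B * (\<gamma> * L) / L\<^sup>2"
proof -
  define f where "f m = B * \<gamma>\<^sup>2 * (1 / (\<gamma> * L + real m)\<^sup>2)" for m
  have f0: "f m \<ge> 0" for m using B(1) by (simp add: f_def)
  have pair: "\<bar>cutoff_kernel a L (lam *\<^sub>R (\<xi> j - \<xi> k))\<bar> \<le> f (j - k) + f (N - (j - k))"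
    if jk: "j \<in> {1..N}" "k \<in> {1..N}" "k \<le> j" for j k
  proof -
    obtain m where m: "m \<in> {j - k, N - (j - k)}" "norm (\<xi> j - \<xi> k) \<ge> 2 * real m / real N"
      using equally_spaced_distance[OF xi jk] by blast
    have "real m / \<gamma> \<ge> 0"
      using pos by simp
    then have "real m / \<gamma> \<le> 2 * (real m / \<gamma>)"
      by linarith
    also have "\<dots> = lam * (2 * real m / real N)"
      using pos by (simp add: N field_simps)
    also have "\<dots> \<le> norm (lam *\<^sub>R (\<xi> j - \<xi> k))"
      using mult_left_mono[OF m(2), of lam] pos by simp
    finally have le: "(\<gamma> * L + real m) / \<gamma> \<le> L + norm (lam *\<^sub>R (\<xi> j - \<xi> k))"
      using pos by (simp add: add_divide_distrib)
    have "\<bar>cutoff_kernel a L (lam *\<^sub>R (\<xi> j - \<xi> k))\<bar> \<le> B / (L + norm (lam *\<^sub>R (\<xi> j - \<xi> k)))\<^sup>2"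
      by (rule B(2)[OF pos(3)])
    also have "\<dots> \<le> B / ((\<gamma> * L + real m) / \<gamma>)\<^sup>2"
      using B(1) pos le T by (intro divide_left_mono power_mono mult_pos_pos zero_less_power)
        (auto intro!: divide_pos_pos add_pos_nonneg)
    also have "\<dots> = f m"
      by (simp add: f_def power_divide)
    also have "\<dots> \<le> f (j - k) + f (N - (j - k))"
      using m(1) f0 by auto
    finally show ?thesis .
  qed
  have "(\<Sum>k=1..N. \<bar>cutoff_kernel a L (lam *\<^sub>R (\<xi> j - \<xi> k))\<bar>) \<le> 4 * (\<Sum>m\<le>N. f m)"
  proof (rule sum_circular_distance_le[where j = j])
    \<comment> \<open>For \<open>j < k\<close> the estimate is applied with the indices exchanged,
      the kernel being even.\<close>
    show "\<bar>cutoff_kernel a L (lam *\<^sub>R (\<xi> j - \<xi> k))\<bar> \<le> f (k - j) + f (N - (k - j))"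
      if "k \<in> {1..N}" "j < k" for k
      using pair[of k j] that j kernel_minus[of a L "lam *\<^sub>R (\<xi> j - \<xi> k)"]
      by (simp flip: scaleR_minus_right)
  qed (use pair j f0 in auto)
  also have "\<dots> \<le> 4 * (B * \<gamma>\<^sup>2 * (1 / (\<gamma> * L)\<^sup>2 + 1 / (\<gamma> * L)))"
    unfolding f_def sum_distrib_left[symmetric]
    using B(1) T by (intro mult_left_mono sum_inverse_square_shift_le) auto
  also have "\<dots> \<le> 4 * (B * \<gamma>\<^sup>2 * (2 / (\<gamma> * L)))"
  proof -
    have "1 / (\<gamma> * L)\<^sup>2 \<le> 1 / (\<gamma> * L)"
      using T by (intro divide_left_mono) (auto simp: power2_eq_square mult_ge1_I mult_le_cancel_left1)
    then have "1 / (\<gamma> * L)\<^sup>2 + 1 / (\<gamma> * L) \<le> 1 / (\<gamma> * L) + 1 / (\<gamma> * L)"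
      by (rule add_right_mono)
    then have "1 / (\<gamma> * L)\<^sup>2 + 1 / (\<gamma> * L) \<le> 2 / (\<gamma> * L)"
      by (simp flip: add_divide_distrib)
    then show ?thesis
      using B(1) by (intro mult_left_mono) auto
  qed
  also have "\<dots> = 8 * B * (\<gamma> * L) / L\<^sup>2"
    using pos by (simp add: field_simps power2_eq_square)
  finally show ?thesis .
qed

text \<open>These bounds hold at each single \<open>lam\<close>, so that only a limit is left for
  the theorem. In the expectation the kernel at 0 is the main term; the off-diagonal part is
  controlled because the factor \<open>T\<close> of a row sum cancels against the 1 /
  \<open>T\<close> in the square of the mean.\<close>

lemma wave_mass_moments:
  fixes X :: "nat \<Rightarrow> 'w \<Rightarrow> real"
  assumes a: "cutoff_function a"
    and B: "B > 0" "\<And>L w. L > 0 \<Longrightarrow> \<bar>cutoff_kernel a L w\<bar> \<le> B / (L + norm w)\<^sup>2"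
    and \<alpha>: "0 < \<alpha>" and \<gamma>: "\<gamma> \<ge> 1" and lam: "lam \<ge> 1" and N: "real N = \<gamma> * lam" and p: "p \<in> {0..1}"
    and pK: "\<bar>p - 1/2\<bar> \<le> K * lam powr (-\<alpha>/2) * \<gamma> powr (-1/2)"
    and xi: "equally_spaced_directions N \<xi>" and X: "independent_signs M p N X"
  defines "mass \<equiv> \<lambda>\<omega>. local_mass a \<alpha> lam (wave \<gamma> lam N \<xi> (\<lambda>j. X j \<omega>))"
  defines "v \<equiv> disc_area (lam powr (-\<alpha>))"
  shows "(1 - 4 * K\<^sup>2 / \<gamma>) * v \<le> prob_space.expectation M mass"
    and "prob_space.expectation M mass \<le> B * (1 + 32 * K\<^sup>2) * v"
    and "prob_space.variance M mass \<le> B\<^sup>2 * (8192 * K\<^sup>2 + 512) * (lam powr (\<alpha> - 1) * v\<^sup>2)"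
proof -
  interpret prob_space M
    using X by (simp add: independent_signs_def)
  define L where "L = lam powr \<alpha>"
  define T where "T = \<gamma> * L"
  define q where "q = 2 * p - 1"
  define g where "g j k = cutoff_kernel a L (lam *\<^sub>R (\<xi> j - \<xi> k))" for j k
  define h where "h = (\<lambda>j k. if j = k then 0 else g j k)"
  define Q where "Q = (\<lambda>\<omega>. \<Sum>j=1..N. \<Sum>k=1..N. X j \<omega> * X k \<omega> * g j k)"
  define D where "D = B / L\<^sup>2"
  have L: "L \<ge> 1" using lam \<alpha> by (simp add: L_def ge_one_powr_ge_zero)
  have T: "T \<ge> 1" "T \<ge> \<gamma>"
    using mult_mono[OF \<gamma> L] mult_left_mono[OF L, of \<gamma>] \<gamma> by (auto simp: T_def)
  have Npos: "real N > 0" using N \<gamma> lam by simp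
  have r: "lam powr (-\<alpha>) = 1 / L" using lam by (simp add: L_def powr_minus_divide)
  have v: "v = pi / L\<^sup>2" "v > 0"
    using L by (simp_all add: v_def r disc_area_eq power_divide)
  have D: "D \<ge> 0" "D \<le> B * v"
    using B(1) L pi_ge_two by (auto simp: D_def v intro!: divide_right_mono)
  have q2: "q\<^sup>2 \<le> 4 * K\<^sup>2 / T"
  proof -
    have "q\<^sup>2 = 4 * \<bar>p - 1/2\<bar>\<^sup>2"
      by (simp add: q_def power2_eq_square algebra_simps)
    also have "\<dots> \<le> 4 * (K * lam powr (-\<alpha>/2) * \<gamma> powr (-1/2))\<^sup>2"
      using pK by (intro mult_left_mono power_mono) auto
    also have "(K * lam powr (-\<alpha>/2) * \<gamma> powr (-1/2))\<^sup>2
        = K\<^sup>2 * ((lam powr (-\<alpha>/2))\<^sup>2 * (\<gamma> powr (-1/2))\<^sup>2)"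
      by (simp only: power_mult_distrib mult.assoc)
    also have "(lam powr (-\<alpha>/2))\<^sup>2 = 1 / L"
      using lam r by (simp only: power2_eq_square flip: powr_add) simp
    also have "(\<gamma> powr (-1/2))\<^sup>2 = 1 / \<gamma>"
      using \<gamma> powr_minus_divide[of \<gamma> 1] by (simp only: power2_eq_square flip: powr_add) simp
    also have "4 * (K\<^sup>2 * (1 / L * (1 / \<gamma>))) = 4 * K\<^sup>2 / T"
      by (simp add: T_def)
    finally show ?thesis .
  qed
  have sym: "g j k = g k j" for j k
    using kernel_minus[of a L "lam *\<^sub>R (\<xi> j - \<xi> k)"] by (simp add: g_def flip: scaleR_minus_right)
  have gD: "\<bar>g j k\<bar> \<le> D" for j k
  proof -
    have "\<bar>g j k\<bar> \<le> B / (L + norm (lam *\<^sub>R (\<xi> j - \<xi> k)))\<^sup>2"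
      unfolding g_def using L by (intro B(2)) auto
    also have "\<dots> \<le> D"
      unfolding D_def using B(1) L
      by (intro divide_left_mono power_mono mult_pos_pos zero_less_power) (auto intro!: add_pos_nonneg)
    finally show ?thesis .
  qed
  have row: "(\<Sum>k=1..N. \<bar>h j k\<bar>) \<le> 8 * D * T" if "j \<in> {1..N}" for j
  proof -
    have "(\<Sum>k=1..N. \<bar>h j k\<bar>) \<le> (\<Sum>k=1..N. \<bar>g j k\<bar>)"
      by (intro sum_mono) (simp add: h_def)
    also have "\<dots> \<le> 8 * D * T"
      using kernel_row_sum_le[OF B xi that _ _ _ N, of L] \<gamma> lam L T by (simp add: g_def D_def T_def)
    finally show ?thesis .
  qed
  have mass_eq: "mass = (\<lambda>\<omega>. Q \<omega> / real N)"
    unfolding mass_def Q_def g_def L_def N using \<gamma> lam by (intro ext local_mass_wave[OF a]) auto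
  have EQ: "expectation Q = (\<Sum>j=1..N. g j j) + q\<^sup>2 * (\<Sum>j=1..N. \<Sum>k=1..N. h j k)"
    using independent_signs_quadratic_form(1)[OF X p, of g, OF sym] by (simp only: Q_def h_def q_def)
  have diag: "(\<Sum>j=1..N. g j j) = real N * cutoff_kernel a L 0"
    by (simp add: g_def)
  have g0: "v \<le> cutoff_kernel a L 0" "cutoff_kernel a L 0 \<le> D"
    using kernel_zero_ge[OF a, of L] L gD[of 0 0] by (auto simp: v_def r g_def)
  have E: "expectation mass = cutoff_kernel a L 0 + q\<^sup>2 * (\<Sum>j=1..N. \<Sum>k=1..N. h j k) / real N"
    unfolding mass_eq using Npos by (simp add: EQ diag[simplified] add_divide_distrib)
  have total: "(\<Sum>j=1..N. \<Sum>k=1..N. \<bar>h j k\<bar>) \<le> real N * (8 * D * T)"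
    using sum_mono[OF row, of "{1..N}" "\<lambda>j. j"] by simp
  show "expectation mass \<le> B * (1 + 32 * K\<^sup>2) * v"
  proof -
    have "(\<Sum>j=1..N. \<Sum>k=1..N. h j k) \<le> (\<Sum>j=1..N. \<Sum>k=1..N. \<bar>h j k\<bar>)"
      by (intro sum_mono) auto
    then have "q\<^sup>2 * (\<Sum>j=1..N. \<Sum>k=1..N. h j k) \<le> q\<^sup>2 * (real N * (8 * D * T))"
      using total by (intro mult_left_mono) auto
    also have "\<dots> \<le> 4 * K\<^sup>2 / T * (real N * (8 * D * T))"
      using D T by (intro mult_right_mono q2) auto
    also have "\<dots> = 32 * K\<^sup>2 * D * real N"
      using T by simp
    finally have "q\<^sup>2 * (\<Sum>j=1..N. \<Sum>k=1..N. h j k) / real N \<le> 32 * K\<^sup>2 * D"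
      using Npos by (simp add: field_simps)
    then have "expectation mass \<le> (1 + 32 * K\<^sup>2) * D"
      unfolding E using g0(2) by (simp add: algebra_simps)
    also have "\<dots> \<le> (1 + 32 * K\<^sup>2) * (B * v)"
      using D by (intro mult_left_mono) auto
    finally show ?thesis by (simp add: mult_ac)
  qed
  show "(1 - 4 * K\<^sup>2 / \<gamma>) * v \<le> expectation mass"
  proof -
    \<comment> \<open>The full form with all signs equal to 1 is itself a local mass, hence nonnegative.\<close>
    have "0 \<le> local_mass a \<alpha> lam (wave \<gamma> lam N \<xi> (\<lambda>_. 1))"
      by (simp add: local_mass_def L2_norm_sq_def)
    also have "\<dots> = (\<Sum>j=1..N. \<Sum>k=1..N. g j k) / real N"
      unfolding N using \<gamma> lam by (subst local_mass_wave[OF a]) (auto simp: g_def L_def)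
    also have "(\<Sum>j=1..N. \<Sum>k=1..N. g j k) = (\<Sum>j=1..N. \<Sum>k=1..N. (if k = j then g j j else 0) + h j k)"
      by (intro sum.cong) (auto simp: h_def)
    also have "\<dots> = real N * cutoff_kernel a L 0 + (\<Sum>j=1..N. \<Sum>k=1..N. h j k)"
      by (simp add: sum.distrib diag[simplified])
    finally have "- cutoff_kernel a L 0 \<le> (\<Sum>j=1..N. \<Sum>k=1..N. h j k) / real N"
      using Npos by (simp add: add_divide_distrib)
    then have "q\<^sup>2 * (- cutoff_kernel a L 0) \<le> q\<^sup>2 * ((\<Sum>j=1..N. \<Sum>k=1..N. h j k) / real N)"
      by (intro mult_left_mono) auto
    \<comment> \<open>The expected mass is (1 - q^2) times the kernel at 0 plus q^2 times the
      nonnegative full form divided by \<open>N\<close>.\<close>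
    then have low: "(1 - q\<^sup>2) * cutoff_kernel a L 0 \<le> expectation mass"
      unfolding E by (simp add: algebra_simps)
    have "q\<^sup>2 \<le> 1" using p by (auto simp: q_def abs_square_le_1)
    moreover have "4 * K\<^sup>2 / T \<le> 4 * K\<^sup>2 / \<gamma>"
      using T \<gamma> by (intro divide_left_mono) auto
    ultimately have "(1 - 4 * K\<^sup>2 / \<gamma>) * v \<le> (1 - q\<^sup>2) * v" "(1 - q\<^sup>2) * v \<le> (1 - q\<^sup>2) * cutoff_kernel a L 0"
      using q2 v(2) g0(1) by (auto intro!: mult_right_mono mult_left_mono)
    then show ?thesis using low by linarith
  qed
  show "variance mass \<le> B\<^sup>2 * (8192 * K\<^sup>2 + 512) * (lam powr (\<alpha> - 1) * v\<^sup>2)"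
  proof -
    have "(\<Sum>k=1..N. h j k)\<^sup>2 \<le> (8 * D * T)\<^sup>2" if "j \<in> {1..N}" for j
    proof -
      have "\<bar>\<Sum>k=1..N. h j k\<bar> \<le> 8 * D * T"
        using sum_abs[of "h j" "{1..N}"] row[OF that] by linarith
      from power_mono[OF this, of 2] show ?thesis by simp
    qed
    from sum_mono[OF this, of "{1..N}" "\<lambda>j. j"] have S1: "(\<Sum>j=1..N. (\<Sum>k=1..N. h j k)\<^sup>2) \<le> real N * (8 * D * T)\<^sup>2"
      by simp
    \<comment> \<open>One factor is bounded entrywise by \<open>D\<close> and the other is left to
      the row sums, so the sum of squares has order D^2 T N, with only one factor
      \<open>T\<close>.\<close>
    have "(h j k)\<^sup>2 \<le> D * \<bar>h j k\<bar>" for j k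
      using mult_right_mono[OF gD[of j k], of "\<bar>g j k\<bar>"]
      by (auto simp: h_def power2_eq_square simp flip: abs_mult)
    then have "(\<Sum>j=1..N. \<Sum>k=1..N. (h j k)\<^sup>2) \<le> D * (\<Sum>j=1..N. \<Sum>k=1..N. \<bar>h j k\<bar>)"
      unfolding sum_distrib_left by (intro sum_mono) auto
    also have "\<dots> \<le> D * (real N * (8 * D * T))"
      using total D by (intro mult_left_mono) auto
    finally have S2: "(\<Sum>j=1..N. \<Sum>k=1..N. (h j k)\<^sup>2) \<le> D * (real N * (8 * D * T))" .
    have "variance Q \<le> 32 * q\<^sup>2 * (\<Sum>j=1..N. (\<Sum>k=1..N. h j k)\<^sup>2) + 64 * (\<Sum>j=1..N. \<Sum>k=1..N. (h j k)\<^sup>2)"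
      using independent_signs_quadratic_form(2)[OF X p, of g, OF sym] by (simp only: Q_def h_def q_def)
    also have "\<dots> \<le> 32 * (4 * K\<^sup>2 / T) * (real N * (8 * D * T)\<^sup>2) + 64 * (D * (real N * (8 * D * T)))"
      using q2 S1 S2 T by (intro add_mono mult_mono mult_left_mono) (auto intro!: sum_nonneg)
    also have "\<dots> = (8192 * K\<^sup>2 + 512) * D\<^sup>2 * T * real N"
      using T by (simp add: field_simps power2_eq_square)
    finally have VQ: "variance Q \<le> (8192 * K\<^sup>2 + 512) * D\<^sup>2 * T * real N" .
    have "variance mass = variance Q / (real N)\<^sup>2"
      unfolding mass_eq by (simp flip: diff_divide_distrib add: power_divide)
    also have "\<dots> \<le> (8192 * K\<^sup>2 + 512) * D\<^sup>2 * T * real N / (real N)\<^sup>2"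
      using VQ by (intro divide_right_mono) auto
    also have "\<dots> = (8192 * K\<^sup>2 + 512) * D\<^sup>2 * (T / real N)"
      using Npos by (simp add: power2_eq_square)
    \<comment> \<open>The factor \<gamma> cancels, so the rate of decay does not depend on
      \<gamma>.\<close>
    also have "T / real N = lam powr (\<alpha> - 1)"
      using \<gamma> lam by (simp add: T_def N L_def powr_diff)
    also have "(8192 * K\<^sup>2 + 512) * D\<^sup>2 * lam powr (\<alpha> - 1) \<le> (8192 * K\<^sup>2 + 512) * (B * v)\<^sup>2 * lam powr (\<alpha> - 1)"
      using D by (intro mult_right_mono mult_left_mono power_mono) auto
    finally show ?thesis
      by (simp add: power_mult_distrib mult_ac)
  qed
qed

text \<open>Independence of the constants from \<open>lam\<close> and \<gamma> is expressed by
  choosing them before all functions of \<open>lam\<close>. The probability space may change with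
  \<open>lam\<close>, and the hypotheses other than the growth of \<gamma> are asked only for large
  \<open>lam\<close>.\<close>

theorem corollary3p2:
  fixes \<alpha> K :: real and a :: "real \<Rightarrow> real"
  assumes "0 < \<alpha>" and "\<alpha> < 1" and "K > 0" and "cutoff_function a"
  shows "\<exists>c>0. \<exists>C>0.
    \<forall>(\<gamma> :: real \<Rightarrow> real) (p :: real \<Rightarrow> real) (N :: real \<Rightarrow> nat) (\<xi> :: real \<Rightarrow> nat \<Rightarrow> real ^ 2)
      (M :: real \<Rightarrow> 'w measure) (X :: real \<Rightarrow> nat \<Rightarrow> 'w \<Rightarrow> real).
      filterlim \<gamma> at_top at_top \<and>
      (\<forall>\<^sub>F lam in at_top.
         real (N lam) = \<gamma> lam * lam \<and>
         p lam \<in> {0..1} \<and>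
         \<bar>p lam - 1/2\<bar> \<le> K * lam powr (-\<alpha>/2) * \<gamma> lam powr (-1/2) \<and>
         equally_spaced_directions (N lam) (\<xi> lam) \<and>
         independent_signs (M lam) (p lam) (N lam) (X lam))
      \<longrightarrow>
      (let mass = (\<lambda>lam \<omega>. local_mass a \<alpha> lam
                     (wave (\<gamma> lam) lam (N lam) (\<xi> lam) (\<lambda>j. X lam j \<omega>)));
           vol = (\<lambda>lam. disc_area (lam powr (-\<alpha>)))
       in (\<lambda>lam. prob_space.variance (M lam) (mass lam)) \<in> o[at_top](\<lambda>lam. (vol lam)\<^sup>2) \<and>
          (\<forall>\<^sub>F lam in at_top.
             c * vol lam \<le> prob_space.expectation (M lam) (mass lam) \<and>
             prob_space.expectation (M lam) (mass lam) \<le> C * vol lam))"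
proof -
  obtain B where B: "B > 0" "\<And>L w. L > 0 \<Longrightarrow> \<bar>cutoff_kernel a L w\<bar> \<le> B / (L + norm w)\<^sup>2"
    using kernel_decay[OF assms(4)] by metis
  define V where "V = B\<^sup>2 * (8192 * K\<^sup>2 + 512)"
  have "(\<lambda>lam. prob_space.variance (M lam) (mass lam)) \<in> o[at_top](\<lambda>lam. (vol lam)\<^sup>2) \<and>
      (\<forall>\<^sub>F lam in at_top. 1/2 * vol lam \<le> prob_space.expectation (M lam) (mass lam) \<and>
         prob_space.expectation (M lam) (mass lam) \<le> B * (1 + 32 * K\<^sup>2) * vol lam)"
    if lim: "filterlim \<gamma> at_top at_top"
      and ev: "\<forall>\<^sub>F lam in at_top.
         real (N lam) = \<gamma> lam * lam \<and> p lam \<in> {0..1} \<and>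
         \<bar>p lam - 1/2\<bar> \<le> K * lam powr (-\<alpha>/2) * \<gamma> lam powr (-1/2) \<and>
         equally_spaced_directions (N lam) (\<xi> lam) \<and>
         independent_signs (M lam) (p lam) (N lam) (X lam)"
      and mass: "mass = (\<lambda>lam \<omega>. local_mass a \<alpha> lam
                     (wave (\<gamma> lam) lam (N lam) (\<xi> lam) (\<lambda>j. X lam j \<omega>)))"
      and vol: "vol = (\<lambda>lam. disc_area (lam powr (-\<alpha>)))"
    for \<gamma> p :: "real \<Rightarrow> real" and N :: "real \<Rightarrow> nat" and \<xi> and M :: "real \<Rightarrow> 'w measure"
      and X mass vol
  proof -
    \<comment> \<open>Beyond 8 K^2 the loss 4 K^2 / \<gamma> in the lower bound is at most 1 / 2,
      which gives the constant 1 / 2.\<close>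
    have "\<forall>\<^sub>F lam in at_top. \<gamma> lam \<ge> max 1 (8 * K\<^sup>2)"
      using lim unfolding filterlim_at_top by blast
    with ev eventually_ge_at_top[of 1]
    have main: "\<forall>\<^sub>F lam in at_top.
        1/2 * vol lam \<le> prob_space.expectation (M lam) (mass lam) \<and>
        prob_space.expectation (M lam) (mass lam) \<le> B * (1 + 32 * K\<^sup>2) * vol lam \<and>
        norm (prob_space.variance (M lam) (mass lam)) \<le> V * norm (lam powr (\<alpha> - 1) * (vol lam)\<^sup>2)"
    proof eventually_elim
      case (elim lam)
      then have \<gamma>: "\<gamma> lam \<ge> 1" "\<gamma> lam \<ge> 8 * K\<^sup>2" and lam: "lam \<ge> 1"
        and rest: "real (N lam) = \<gamma> lam * lam" "p lam \<in> {0..1}"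
         "\<bar>p lam - 1/2\<bar> \<le> K * lam powr (-\<alpha>/2) * \<gamma> lam powr (-1/2)"
         "equally_spaced_directions (N lam) (\<xi> lam)"
         "independent_signs (M lam) (p lam) (N lam) (X lam)"
        by auto
      note moments = wave_mass_moments[OF assms(4) B assms(1) \<gamma>(1) lam rest]
      have "1/2 \<le> 1 - 4 * K\<^sup>2 / \<gamma> lam"
        using \<gamma> by (simp add: field_simps)
      then have "1/2 * vol lam \<le> (1 - 4 * K\<^sup>2 / \<gamma> lam) * vol lam"
        by (intro mult_right_mono) (auto simp: vol disc_area_def)
      moreover have "prob_space.variance (M lam) (mass lam) \<ge> 0"
        by (rule integral_nonneg_AE) simp
      ultimately show ?case
        using moments by (auto simp: mass vol V_def)
    qed
    \<comment> \<open>Here \<alpha> < 1 enters: it makes the exponent negative, and the variance is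
      this vanishing factor times a bounded multiple of the squared area.\<close>
    have "((\<lambda>lam::real. lam powr (\<alpha> - 1)) \<longlongrightarrow> 0) at_top"
      using assms(2) by (intro tendsto_neg_powr filterlim_ident) auto
    then have "(\<lambda>lam. lam powr (\<alpha> - 1)) \<in> o[at_top](\<lambda>_. 1)"
      by (intro smalloI_tendsto) auto
    then have "(\<lambda>lam. lam powr (\<alpha> - 1) * (vol lam)\<^sup>2) \<in> o[at_top](\<lambda>lam. 1 * (vol lam)\<^sup>2)"
      by (rule landau_o.small_big_mult) simp
    moreover have "(\<lambda>lam. prob_space.variance (M lam) (mass lam)) \<in> O[at_top](\<lambda>lam. lam powr (\<alpha> - 1) * (vol lam)\<^sup>2)"
      by (rule bigoI[where c = V]) (use main in eventually_elim, simp)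
    ultimately have "(\<lambda>lam. prob_space.variance (M lam) (mass lam)) \<in> o[at_top](\<lambda>lam. (vol lam)\<^sup>2)"
      using landau_o.big_small_trans by fastforce
    moreover have "\<forall>\<^sub>F lam in at_top. 1/2 * vol lam \<le> prob_space.expectation (M lam) (mass lam) \<and>
         prob_space.expectation (M lam) (mass lam) \<le> B * (1 + 32 * K\<^sup>2) * vol lam"
      using main by eventually_elim auto
    ultimately show ?thesis ..
  qed
  moreover have "B * (1 + 32 * K\<^sup>2) > 0"
    using B(1) by (intro mult_pos_pos) (auto intro: add_pos_nonneg)
  ultimately show ?thesis
    unfolding Let_def
    by (intro exI[of _ "1/2 :: real"] exI[of _ "B * (1 + 32 * K\<^sup>2)"] conjI allI impI; (elim conjE)?; simp)
qed

end
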